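(* Let $\lambda\neq0$. Suppose that $M$ is a surface in $\mathbb{S}^2\times\mathbb{R}$ invariant by the group of vertical translations generated by $\partial_z$. Then $M$ is a $\lambda$-translator if and only if its generating curve is a closed circle in $\mathbb{S}^2$ of constant geodesic curvature $\kappa_g=2\lambda$.
   Context: $\mathbb{S}^2$ is the unit sphere with its round metric, $\mathbb{S}^2\times\mathbb{R}$ carries the product metric, points are written $(p,z)$, and $\partial_z=(0,1)$ is the unit vertical Killing field, whose flow consists of the vertical translations $T_t(p,z)=(p,z+t)$. An oriented surface $M$ in $\mathbb{S}^2\times\mathbb{R}$ with unit normal $N$ is a $\lambda$-translator if its mean curvature $H$ satisfies $H=\langle N,\partial_z\rangle+\lambda$ at every point. Here $H$ is half the trace of the second fundamental form with respect to $N$, with sign such that the graph $z=u(p)$ oriented by the upward normal $N=(-\nabla u+\partial_z)/\sqrt{1+|\nabla u|^2}$ has $2H=\operatorname{div}\big(\nabla u/\sqrt{1+|\nabla u|^2}\big)$ (gradient and divergence of $\mathbb{S}^2$). A surface invariant by the vertical translations is of the form $M=\gamma\times\mathbb{R}$ with $\gamma\subset\mathbb{S}^2$ a curve, called its generating curve. Its unit normal is $N=(\mathbf{n}_\gamma,0)$ with $\mathbf{n}_\gamma$ a unit normal along $\gamma$ in $\mathbb{S}^2$, and the geodesic curvature $\kappa_g$ of $\gamma$ is computed with respect to $\mathbf{n}_\gamma$, so that $H=\kappa_g/2$.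
   Formalization: The surface M is additionally assumed connected and complete; otherwise an open arc of a circle with geodesic curvature 2λ times the line, or two disjoint such circles times the line, would be a λ-translator whose generating curve is not a closed circle. *)

theory Defs
  imports "HOL-Analysis.Analysis"
begin

text \<open>
  The product of the unit sphere and the line is the subset \<open>sphere 0 1 \<times> UNIV\<close> of
  the Euclidean space \<open>(real^3) \<times> real\<close>; the product metric is the one induced by the
  inner product of that space. A surface is an immersed surface of class C2: a topological
  space \<open>S\<close> together with a map \<open>F\<close> that is, in suitable local coordinates, an immersion.
  Embedded surfaces are the case where \<open>S\<close> is the subset itself and \<open>F\<close> the identity.
\<close>

fun Ck_on :: "nat \<Rightarrow> ('a::euclidean_space \<Rightarrow> 'b::real_normed_vector) \<Rightarrow> 'a set \<Rightarrow> bool" where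
  "Ck_on 0 f U \<longleftrightarrow> continuous_on U f"
| "Ck_on (Suc k) f U \<longleftrightarrow>
     f differentiable_on U \<and> (\<forall>b\<in>Basis. Ck_on k (\<lambda>x. frechet_derivative f (at x) b) U)"

definition vtrans :: "real \<Rightarrow> (real^3) \<times> real \<Rightarrow> (real^3) \<times> real" where
  "vtrans t q = (fst q, snd q + t)"

definition dz :: "(real^3) \<times> real" where
  "dz = (0, 1)"


section \<open>Immersed surfaces\<close>

definition local_param ::
  "'a::t2_space set \<Rightarrow> ('a \<Rightarrow> (real^3) \<times> real) \<Rightarrow> (real^2) set \<Rightarrow> (real^2 \<Rightarrow> 'a) \<Rightarrow> bool" where
  "local_param S F U \<phi> \<longleftrightarrow>
     open U \<and> \<phi> ` U \<subseteq> S \<and> openin (top_of_set S) (\<phi> ` U) \<and>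
     (\<exists>\<psi>. homeomorphism U (\<phi> ` U) \<phi> \<psi>) \<and>
     Ck_on 2 (F \<circ> \<phi>) U \<and> (\<forall>u\<in>U. inj (frechet_derivative (F \<circ> \<phi>) (at u)))"

text \<open>
  No compatibility of the parametrizations is required: since \<open>F\<close> is an immersion in each of
  them, the changes of coordinates are automatically of class C2.
\<close>

definition immersed_surface :: "'a::t2_space set \<Rightarrow> ('a \<Rightarrow> (real^3) \<times> real) \<Rightarrow> bool" where
  "immersed_surface S F \<longleftrightarrow>
     S \<noteq> {} \<and> F ` S \<subseteq> sphere 0 1 \<times> UNIV \<and>
     (\<forall>x\<in>S. \<exists>U \<phi>. local_param S F U \<phi> \<and> x \<in> \<phi> ` U)"

text \<open>
  \<open>N x\<close> is tangent to the product of the sphere and the line at \<open>F x\<close>, that is, its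
  spherical component is orthogonal to that of \<open>F x\<close>, and it is normal to the surface.
\<close>

definition unit_normal ::
  "'a::t2_space set \<Rightarrow> ('a \<Rightarrow> (real^3) \<times> real) \<Rightarrow> ('a \<Rightarrow> (real^3) \<times> real) \<Rightarrow> bool" where
  "unit_normal S F N \<longleftrightarrow>
     continuous_on S N \<and>
     (\<forall>x\<in>S. norm (N x) = 1 \<and> fst (N x) \<bullet> fst (F x) = 0) \<and>
     (\<forall>U \<phi>. local_param S F U \<phi> \<longrightarrow>
        (\<forall>u\<in>U. \<forall>v. N (\<phi> u) \<bullet> frechet_derivative (F \<circ> \<phi>) (at u) v = 0))"

text \<open>
  Completeness of the induced length metric: a sequence that is Cauchy for the intrinsic distance
  (the infimum of the lengths of the joining curves) converges in \<open>S\<close>. A path is taken of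
  class C1 with two-sided derivatives also at the end points, so that its length integral exists.
\<close>

definition joined_by_length_less ::
  "'a::t2_space set \<Rightarrow> ('a \<Rightarrow> (real^3) \<times> real) \<Rightarrow> 'a \<Rightarrow> 'a \<Rightarrow> real \<Rightarrow> bool" where
  "joined_by_length_less S F x y e \<longleftrightarrow>
     (\<exists>\<alpha>. path \<alpha> \<and> path_image \<alpha> \<subseteq> S \<and> pathstart \<alpha> = x \<and> pathfinish \<alpha> = y \<and>
          (F \<circ> \<alpha>) C1_differentiable_on {0..1} \<and>
          integral {0..1} (\<lambda>t. norm (vector_derivative (F \<circ> \<alpha>) (at t))) < e)"

definition complete_surface :: "'a::t2_space set \<Rightarrow> ('a \<Rightarrow> (real^3) \<times> real) \<Rightarrow> bool" where
  "complete_surface S F \<longleftrightarrow>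
     (\<forall>\<sigma>::nat \<Rightarrow> 'a. range \<sigma> \<subseteq> S \<and>
        (\<forall>e>0. \<exists>K. \<forall>m\<ge>K. \<forall>n\<ge>K. joined_by_length_less S F (\<sigma> m) (\<sigma> n) e)
        \<longrightarrow> (\<exists>x\<in>S. \<sigma> \<longlonglongrightarrow> x))"


section \<open>Mean curvature and translators\<close>

abbreviation partial ::
  "2 \<Rightarrow> (real^2 \<Rightarrow> 'b::real_normed_vector) \<Rightarrow> real^2 \<Rightarrow> 'b" where
  "partial i X u \<equiv> frechet_derivative X (at u) (axis i 1)"

definition first_form :: "(real^2 \<Rightarrow> (real^3) \<times> real) \<Rightarrow> real^2 \<Rightarrow> real^2^2" where
  "first_form X u = (\<chi> i j. partial i X u \<bullet> partial j X u)"

text \<open>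
  The Levi-Civita connection of the product is the tangential projection of the flat derivative, and
  the normal \<open>\<nu>\<close> is tangent to the product. Hence the second fundamental form with respect
  to \<open>\<nu>\<close> is obtained from the flat second derivatives. On a graph over the sphere oriented
  upwards, twice the mean curvature below is the divergence of the normalized gradient.
\<close>

definition second_form ::
  "(real^2 \<Rightarrow> (real^3) \<times> real) \<Rightarrow> (real^3) \<times> real \<Rightarrow> real^2 \<Rightarrow> real^2^2" where
  "second_form X \<nu> u = (\<chi> i j. partial i (partial j X) u \<bullet> \<nu>)"

definition mean_curvature ::
  "(real^2 \<Rightarrow> (real^3) \<times> real) \<Rightarrow> (real^3) \<times> real \<Rightarrow> real^2 \<Rightarrow> real" where
  "mean_curvature X \<nu> u = trace (matrix_inv (first_form X u) ** second_form X \<nu> u) / 2"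

definition translator ::
  "'a::t2_space set \<Rightarrow> ('a \<Rightarrow> (real^3) \<times> real) \<Rightarrow> ('a \<Rightarrow> (real^3) \<times> real) \<Rightarrow> real \<Rightarrow> bool" where
  "translator S F N \<Lambda> \<longleftrightarrow>
     (\<forall>U \<phi>. local_param S F U \<phi> \<longrightarrow>
        (\<forall>u\<in>U. mean_curvature (F \<circ> \<phi>) (N (\<phi> u)) u = N (\<phi> u) \<bullet> dz + \<Lambda>))"


section \<open>Vertical invariance and the generating curve\<close>

text \<open>
  For an immersed surface, invariance means that the vertical translations lift to a continuous
  action of the group of reals on the surface.
\<close>

definition vertically_invariant :: "'a::t2_space set \<Rightarrow> ('a \<Rightarrow> (real^3) \<times> real) \<Rightarrow> bool" where
  "vertically_invariant S F \<longleftrightarrow>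
     (\<exists>\<tau>::real \<Rightarrow> 'a \<Rightarrow> 'a.
        continuous_on (UNIV \<times> S) (\<lambda>(t, x). \<tau> t x) \<and>
        (\<forall>x\<in>S. \<tau> 0 x = x) \<and>
        (\<forall>t. \<forall>x\<in>S. \<tau> t x \<in> S \<and> F (\<tau> t x) = vtrans t (F x)) \<and>
        (\<forall>s t. \<forall>x\<in>S. \<tau> (s + t) x = \<tau> s (\<tau> t x)))"

text \<open>For embedded surfaces this is invariance of the subset.\<close>

lemma vertically_invariant_embedded:
  "vertically_invariant M (\<lambda>q. q) \<longleftrightarrow> (\<forall>t. vtrans t ` M = M)"
proof
  assume "vertically_invariant M (\<lambda>q. q)"
  then have mem: "vtrans t q \<in> M" if "q \<in> M" for t q
    using that unfolding vertically_invariant_def by metis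
  show "\<forall>t. vtrans t ` M = M"
  proof (intro allI equalityI subsetI)
    fix t q assume "q \<in> M"
    then have "vtrans (- t) q \<in> M" and "q = vtrans t (vtrans (- t) q)"
      by (simp_all add: mem) (simp add: vtrans_def)
    then show "q \<in> vtrans t ` M" by blast
  qed (use mem in blast)
next
  assume inv: "\<forall>t. vtrans t ` M = M"
  have "continuous_on (UNIV \<times> M) (\<lambda>(t, x). vtrans t x)"
    unfolding vtrans_def case_prod_unfold by (intro continuous_intros)
  moreover have "\<forall>x\<in>M. vtrans 0 x = x"
    and "\<forall>s t. \<forall>x\<in>M. vtrans (s + t) x = vtrans s (vtrans t x)"
    by (simp_all add: vtrans_def)
  ultimately show "vertically_invariant M (\<lambda>q. q)"
    unfolding vertically_invariant_def using inv by (intro exI[of _ vtrans]) blast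
qed

definition generating_curve :: "'a::t2_space set \<Rightarrow> ('a \<Rightarrow> (real^3) \<times> real) \<Rightarrow> (real^3) set" where
  "generating_curve S F = {p. (p, 0) \<in> F ` S}"

lemma vertically_invariant_eq_cylinder:
  assumes "vertically_invariant S F"
  shows "F ` S = generating_curve S F \<times> UNIV"
proof -
  have mem: "vtrans t q \<in> F ` S" if "q \<in> F ` S" for t q
    using assms that unfolding vertically_invariant_def by (metis image_iff)
  have "(p, z) \<in> F ` S \<longleftrightarrow> (p, 0) \<in> F ` S" for p z
    using mem[of "(p, z)" "- z"] mem[of "(p, 0)" z] by (auto simp: vtrans_def)
  then show ?thesis unfolding generating_curve_def by (simp add: set_eq_iff)
qed


section \<open>Curves in the sphere\<close>

definition sphere_circle :: "(real^3) set \<Rightarrow> bool" where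
  "sphere_circle C \<longleftrightarrow>
     (\<exists>a d. norm a = 1 \<and> \<bar>d\<bar> < 1 \<and> C = {p \<in> sphere 0 1. p \<bullet> a = d})"

definition regular_curve_in :: "(real^3) set \<Rightarrow> (real \<Rightarrow> real^3) \<Rightarrow> real set \<Rightarrow> bool" where
  "regular_curve_in C c I \<longleftrightarrow>
     open I \<and> Ck_on 2 c I \<and> c ` I \<subseteq> C \<and> (\<forall>s\<in>I. vector_derivative c (at s) \<noteq> 0)"

text \<open>
  Geodesic curvature in the sphere at parameter \<open>s\<close> with respect to the unit vector \<open>n\<close>,
  which is tangent to the sphere and normal to the curve; the parametrization need not have unit
  speed, and its acceleration differs from the covariant one by a multiple of the position vector.
\<close>

definition geodesic_curvature :: "(real \<Rightarrow> real^3) \<Rightarrow> real^3 \<Rightarrow> real \<Rightarrow> real" where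
  "geodesic_curvature c n s =
     vector_derivative (\<lambda>t. vector_derivative c (at t)) (at s) \<bullet> n
       / (norm (vector_derivative c (at s)))\<^sup>2"

definition has_geodesic_curvature ::
  "(real^3) set \<Rightarrow> real^3 \<Rightarrow> real^3 \<Rightarrow> real \<Rightarrow> bool" where
  "has_geodesic_curvature C p n k \<longleftrightarrow>
     (\<exists>c I s. regular_curve_in C c I \<and> s \<in> I \<and> c s = p) \<and>
     (\<forall>c I s. regular_curve_in C c I \<and> s \<in> I \<and> c s = p \<longrightarrow> geodesic_curvature c n s = k)"

text \<open>
  On a vertically invariant surface the unit normal is horizontal, so \<open>fst (N x)\<close> is the
  unit normal of the generating curve at the point \<open>fst (F x)\<close>.
\<close>

definition generating_curve_has_curvature ::
  "'a::t2_space set \<Rightarrow> ('a \<Rightarrow> (real^3) \<times> real) \<Rightarrow> ('a \<Rightarrow> (real^3) \<times> real) \<Rightarrow> real \<Rightarrow> bool" where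
  "generating_curve_has_curvature S F N k \<longleftrightarrow>
     (\<forall>x\<in>S. has_geodesic_curvature (generating_curve S F) (fst (F x)) (fst (N x)) k)"

end

theory Submission
  imports Defs
begin

text \<open>
  The vertical flow is tangent to the surface, so the unit normal is horizontal, \<open>N = (n, 0)\<close>, and
  \<open>N \<bullet> dz = 0\<close> (\<open>vertical_tangent\<close>, \<open>normal_horizontal\<close>). The translator equation therefore
  says that the mean curvature is \<open>\<Lambda>\<close>. Write \<open>P\<close> for the projection of the surface to the sphere.
  On a cylinder the only principal curvature that can be nonzero is that of the generating
  curve, and \<open>dn = - \<kappa> dP\<close> with mean curvature \<open>\<kappa> / 2\<close> (\<open>cylinder_Weingarten\<close>).
  
  For a translator, \<open>\<kappa> = 2 \<Lambda>\<close>. Then the vector \<open>2 \<Lambda> P + n\<close> is locally constant, hence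
  constant on the connected surface. It is the axis of a circle that contains the image of \<open>P\<close>
  (\<open>translator_in_circle\<close>), and expressing \<open>n\<close> by this axis as \<open>\<mu> (a - d P)\<close> with \<open>\<mu> d = 2 \<Lambda>\<close>
  gives the curvature of all curves in the circle (\<open>geodesic_curvature_in_circle\<close>). That
  the image is not just an arc follows from completeness: the surface is locally homeomorphic to the
  product of the circle and the line, the circle lifts locally at constant height, and in a complete
  surface these lifts continue indefinitely (\<open>horizontal_lift_exists\<close>).
  
  Conversely, over a circle with axis \<open>a\<close> at height \<open>d\<close> the normal is \<open>\<mu> (a - d P)\<close>
  (\<open>circle_normal\<close>); curves in the circle have geodesic curvature \<open>\<mu> d\<close>, and the mean
  curvature is \<open>\<mu> d / 2\<close> (\<open>circle_mean_curvature\<close>).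
\<close>


section \<open>Second derivatives in the plane\<close>

lemma inner_derivative_const:
  fixes f g :: "'a::real_normed_vector \<Rightarrow> 'b::real_inner"
  assumes "open U" "u \<in> U" and "\<And>x. x \<in> U \<Longrightarrow> f x \<bullet> g x = c"
    and "(f has_derivative f') (at u)" "(g has_derivative g') (at u)"
  shows "f' v \<bullet> g u + f u \<bullet> g' v = 0"
proof -
  have "((\<lambda>x. f x \<bullet> g x) has_derivative (\<lambda>v. f u \<bullet> g' v + f' v \<bullet> g u)) (at u)"
    by (intro has_derivative_inner assms)
  moreover have "((\<lambda>x. f x \<bullet> g x) has_derivative (\<lambda>v. 0)) (at u)"
    by (rule has_derivative_transform_within_open[OF has_derivative_const[of c] assms(1,2)])
       (simp add: assms(3))
  ultimately have "(\<lambda>v. f u \<bullet> g' v + f' v \<bullet> g u) = (\<lambda>v. 0)"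
    by (rule has_derivative_unique)
  then show ?thesis by (metis add.commute)
qed

lemma Ck_on_2_derivatives:
  assumes "Ck_on 2 X U" "open U" "u \<in> U" "b \<in> Basis" "b' \<in> Basis"
  shows "(X has_derivative frechet_derivative X (at u)) (at u)"
    and "((\<lambda>x. frechet_derivative X (at x) b) has_derivative
           frechet_derivative (\<lambda>x. frechet_derivative X (at x) b) (at u)) (at u)"
    and "continuous_on U (\<lambda>x. frechet_derivative (\<lambda>y. frechet_derivative X (at y) b) (at x) b')"
  using assms
  by (auto simp: numeral_2_eq_2 differentiable_on_eq_differentiable_at frechet_derivative_works)

text \<open>
  Two applications of the mean value theorem, first in the direction \<open>a\<close> and then in the
  direction \<open>b\<close>. The left-hand side is symmetric in \<open>a\<close> and \<open>b\<close>, the right-hand side is a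
  value of the mixed second derivative near \<open>u\<close>.
\<close>
lemma second_difference_mean_value:
  fixes g :: "'a::real_normed_vector \<Rightarrow> real"
  assumes h: "0 < h" "h * (norm a + norm b) < r"
    and g: "\<And>x. x \<in> ball u r \<Longrightarrow> (g has_derivative D x) (at x)"
    and D: "\<And>x. x \<in> ball u r \<Longrightarrow> ((\<lambda>y. D y a) has_derivative E x) (at x)"
  obtains p where "norm (p - u) \<le> h * (norm a + norm b)"
    and "g (u + h *\<^sub>R a + h *\<^sub>R b) - g (u + h *\<^sub>R a) - g (u + h *\<^sub>R b) + g u = h\<^sup>2 * E p b"
proof -
  have small: "norm (s *\<^sub>R a + t *\<^sub>R b) \<le> h * (norm a + norm b)"
    if "0 \<le> s" "s \<le> h" "0 \<le> t" "t \<le> h" for s t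
  proof -
    have "norm (s *\<^sub>R a + t *\<^sub>R b) \<le> s * norm a + t * norm b"
      using norm_triangle_ineq[of "s *\<^sub>R a" "t *\<^sub>R b"] that by simp
    also have "\<dots> \<le> h * norm a + h * norm b"
      using that by (intro add_mono mult_right_mono) auto
    finally show ?thesis by (simp add: algebra_simps)
  qed
  have inb: "u + s *\<^sub>R a + t *\<^sub>R b \<in> ball u r"
    if "0 \<le> s" "s \<le> h" "0 \<le> t" "t \<le> h" for s t
  proof -
    have "dist u (u + s *\<^sub>R a + t *\<^sub>R b) = norm (s *\<^sub>R a + t *\<^sub>R b)"
      by (metis add.assoc add_diff_cancel_left' dist_commute dist_norm)
    then show ?thesis using small[OF that] h by simp
  qed
  have lin: "D x (c *\<^sub>R v) = c * D x v" if "x \<in> ball u r" for x c v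
    using linear_cmul[OF has_derivative_linear[OF g[OF that]]] by simp
  have linE: "E x (c *\<^sub>R v) = c * E x v" if "x \<in> ball u r" for x c v
    using linear_cmul[OF has_derivative_linear[OF D[OF that]]] by simp
  define f where "f s = g (u + s *\<^sub>R a + h *\<^sub>R b) - g (u + s *\<^sub>R a + 0 *\<^sub>R b)" for s
  have df: "(f has_real_derivative D (u + s *\<^sub>R a + h *\<^sub>R b) a - D (u + s *\<^sub>R a + 0 *\<^sub>R b) a) (at s)"
    if "0 \<le> s" "s \<le> h" for s
  proof -
    have "((\<lambda>s. g (u + s *\<^sub>R a + t *\<^sub>R b)) has_derivative (\<lambda>k. D (u + s *\<^sub>R a + t *\<^sub>R b) (k *\<^sub>R a))) (at s)"
      if t: "0 \<le> t" "t \<le> h" for t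
      by (rule has_derivative_compose[where g = g and f = "\<lambda>s. u + s *\<^sub>R a + t *\<^sub>R b",
            OF _ g[OF inb[OF \<open>0 \<le> s\<close> \<open>s \<le> h\<close> t]]])
         (auto intro!: derivative_eq_intros)
    from this[of h] this[of 0] h(1) have "(f has_derivative
        (\<lambda>k. D (u + s *\<^sub>R a + h *\<^sub>R b) (k *\<^sub>R a) - D (u + s *\<^sub>R a + 0 *\<^sub>R b) (k *\<^sub>R a))) (at s)"
      unfolding f_def by (intro has_derivative_diff) auto
    then show ?thesis
      unfolding has_field_derivative_def
      by (rule has_derivative_eq_rhs)
         (simp only: fun_eq_iff lin[OF inb[OF that, of h]] lin[OF inb[OF that, of 0]] order.refl h(1)[THEN less_imp_le],
          simp add: algebra_simps)
  qed
  obtain s where s: "0 < s" "s < h"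
    "f h - f 0 = (h - 0) * (D (u + s *\<^sub>R a + h *\<^sub>R b) a - D (u + s *\<^sub>R a + 0 *\<^sub>R b) a)"
    using MVT2[OF h(1) df] by auto
  have dk: "((\<lambda>t. D (u + s *\<^sub>R a + t *\<^sub>R b) a) has_real_derivative E (u + s *\<^sub>R a + t *\<^sub>R b) b) (at t)"
    if "0 \<le> t" "t \<le> h" for t
  proof -
    have "((\<lambda>t. D (u + s *\<^sub>R a + t *\<^sub>R b) a) has_derivative (\<lambda>k. E (u + s *\<^sub>R a + t *\<^sub>R b) (k *\<^sub>R b))) (at t)"
      by (rule has_derivative_compose[where g = "\<lambda>x. D x a" and f = "\<lambda>t. u + s *\<^sub>R a + t *\<^sub>R b", OF _ D[OF inb]])
        (use s that in \<open>auto intro!: derivative_eq_intros\<close>)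
    then show ?thesis
      unfolding has_field_derivative_def
      by (rule has_derivative_eq_rhs) (use inb that s in \<open>auto simp: fun_eq_iff linE\<close>)
  qed
  obtain t where t: "0 < t" "t < h"
    "D (u + s *\<^sub>R a + h *\<^sub>R b) a - D (u + s *\<^sub>R a + 0 *\<^sub>R b) a = (h - 0) * E (u + s *\<^sub>R a + t *\<^sub>R b) b"
    using MVT2[OF h(1) dk] by auto
  show ?thesis
  proof
    show "norm (u + s *\<^sub>R a + t *\<^sub>R b - u) \<le> h * (norm a + norm b)"
      using small[of s t] s t by (simp add: add.assoc)
    have "g (u + h *\<^sub>R a + h *\<^sub>R b) - g (u + h *\<^sub>R a) - g (u + h *\<^sub>R b) + g u = f h - f 0"
      by (simp add: f_def)
    also have "\<dots> = h\<^sup>2 * E (u + s *\<^sub>R a + t *\<^sub>R b) b"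
      by (simp only: s(3) t(3)) (simp add: power2_eq_square)
    finally show "g (u + h *\<^sub>R a + h *\<^sub>R b) - g (u + h *\<^sub>R a) - g (u + h *\<^sub>R b) + g u
        = h\<^sup>2 * E (u + s *\<^sub>R a + t *\<^sub>R b) b" .
  qed
qed

text \<open>
  Evaluating the second difference in both orders gives points \<open>p\<close> and \<open>q\<close>, as close to \<open>u\<close> as
  desired, at which the two mixed derivatives have equal components along \<open>w\<close>; continuity of the
  second derivatives carries the equality to \<open>u\<close>.
\<close>
lemma mixed_partials_commute:
  fixes X :: "'a::euclidean_space \<Rightarrow> 'b::real_inner"
  assumes X: "Ck_on 2 X U" "open U" "u \<in> U" and ab: "a \<in> Basis" "b \<in> Basis"
  shows "frechet_derivative (\<lambda>x. frechet_derivative X (at x) a) (at u) b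
       = frechet_derivative (\<lambda>x. frechet_derivative X (at x) b) (at u) a"
proof -
  define E where "E a b x = frechet_derivative (\<lambda>x. frechet_derivative X (at x) a) (at x) b" for a b x
  have "E a b u \<bullet> w = E b a u \<bullet> w" for w
  proof (rule ccontr)
    assume ne: "E a b u \<bullet> w \<noteq> E b a u \<bullet> w"
    define e where "e = \<bar>E a b u \<bullet> w - E b a u \<bullet> w\<bar> / 2"
    have "e > 0" using ne by (simp add: e_def)
    have cont: "continuous_on U (\<lambda>x. E a b x \<bullet> w)" "continuous_on U (\<lambda>x. E b a x \<bullet> w)"
      unfolding E_def using Ck_on_2_derivatives(3)[OF X] ab by (auto intro!: continuous_intros)
    obtain r0 where r0: "r0 > 0" "ball u r0 \<subseteq> U"
      using X(2,3) openE by blast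
    obtain r1 where r1: "r1 > 0" "\<And>x. x \<in> U \<Longrightarrow> dist x u < r1 \<Longrightarrow> \<bar>E a b x \<bullet> w - E a b u \<bullet> w\<bar> < e"
      using cont(1) X(3) \<open>e > 0\<close> unfolding continuous_on_iff dist_real_def by metis
    obtain r2 where r2: "r2 > 0" "\<And>x. x \<in> U \<Longrightarrow> dist x u < r2 \<Longrightarrow> \<bar>E b a x \<bullet> w - E b a u \<bullet> w\<bar> < e"
      using cont(2) X(3) \<open>e > 0\<close> unfolding continuous_on_iff dist_real_def by metis
    define r where "r = min r0 (min r1 r2)"
    have r: "r > 0" using r0 r1 r2 by (simp add: r_def)
    define h where "h = r / 4"
    have h: "h > 0" "h * (norm a + norm b) < r" "h * (norm b + norm a) < r"
      using r ab by (simp_all add: h_def)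
    have d1: "((\<lambda>x. X x \<bullet> w) has_derivative (\<lambda>v. frechet_derivative X (at x) v \<bullet> w)) (at x)"
      if "x \<in> ball u r" for x
      using Ck_on_2_derivatives(1)[OF X(1,2) _ ab] r0 that
      by (intro has_derivative_inner_left) (auto simp: r_def)
    have d2: "((\<lambda>x. frechet_derivative X (at x) c \<bullet> w) has_derivative (\<lambda>v. E c v x \<bullet> w)) (at x)"
      if "x \<in> ball u r" "c \<in> Basis" for x c
      unfolding E_def using Ck_on_2_derivatives(2)[OF X(1,2) _ that(2) that(2)] r0 that
      by (intro has_derivative_inner_left) (auto simp: r_def)
    obtain p where p: "norm (p - u) \<le> h * (norm a + norm b)"
      "X (u + h *\<^sub>R a + h *\<^sub>R b) \<bullet> w - X (u + h *\<^sub>R a) \<bullet> w - X (u + h *\<^sub>R b) \<bullet> w + X u \<bullet> w = h\<^sup>2 * (E a b p \<bullet> w)"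
      by (rule second_difference_mean_value[OF h(1,2) d1 d2[OF _ ab(1)]])
    obtain q where q: "norm (q - u) \<le> h * (norm b + norm a)"
      "X (u + h *\<^sub>R b + h *\<^sub>R a) \<bullet> w - X (u + h *\<^sub>R b) \<bullet> w - X (u + h *\<^sub>R a) \<bullet> w + X u \<bullet> w = h\<^sup>2 * (E b a q \<bullet> w)"
      by (rule second_difference_mean_value[OF h(1,3) d1 d2[OF _ ab(2)]])
    have "X (u + h *\<^sub>R b + h *\<^sub>R a) = X (u + h *\<^sub>R a + h *\<^sub>R b)"
      by (simp add: ac_simps)
    from p(2) q(2)[unfolded this] have "h\<^sup>2 * (E a b p \<bullet> w) = h\<^sup>2 * (E b a q \<bullet> w)" by linarith
    then have eq: "E a b p \<bullet> w = E b a q \<bullet> w" using h(1) by (metis mult_left_cancel not_less_iff_gr_or_eq zero_less_power)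
    have "dist p u < r" "dist q u < r" using p(1) q(1) h by (auto simp: dist_norm)
    then have "\<bar>E a b p \<bullet> w - E a b u \<bullet> w\<bar> < e" "\<bar>E b a q \<bullet> w - E b a u \<bullet> w\<bar> < e"
      using r0(2) by (auto intro!: r1(2) r2(2) simp: r_def subset_iff dist_commute)
    with eq have "\<bar>E a b u \<bullet> w - E b a u \<bullet> w\<bar> < 2 * e" by linarith
    then show False by (simp add: e_def)
  qed
  then show ?thesis
    unfolding E_def using vector_eq_rdot by blast
qed


section \<open>Linear algebra\<close>

lemma orthonormal_expansion:
  fixes a e q :: "real^3"
  assumes "norm a = 1" "norm e = 1" "a \<bullet> e = 0"
  shows "q = (q \<bullet> a) *\<^sub>R a + (q \<bullet> e) *\<^sub>R e + (q \<bullet> cross3 a e) *\<^sub>R cross3 a e"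
    and "norm (cross3 a e) = 1"
    and "q \<bullet> q = (q \<bullet> a)\<^sup>2 + (q \<bullet> e)\<^sup>2 + (q \<bullet> cross3 a e)\<^sup>2"
proof -
  have sq: "a \<bullet> a = 1" "e \<bullet> e = 1" "e \<bullet> a = 0"
    using assms by (auto simp: norm_eq_1 inner_commute)
  have "(norm (cross3 a e))\<^sup>2 = 1"
    using norm_cross[of a e] assms by simp
  then show n: "norm (cross3 a e) = 1"
    using norm_ge_zero power2_eq_1_iff by (metis norm_minus_cancel norm_not_less_zero less_minus_one_simps(1))
  then have c: "cross3 a e \<bullet> cross3 a e = 1" by (simp add: norm_eq_1)
  \<comment> \<open>The remainder is orthogonal to the third vector, and parallel to it since its cross
    product with it vanishes by the Lagrange identity.\<close>
  define w where "w = q - ((q \<bullet> a) *\<^sub>R a + (q \<bullet> e) *\<^sub>R e + (q \<bullet> cross3 a e) *\<^sub>R cross3 a e)"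
  have w: "w \<bullet> a = 0" "w \<bullet> e = 0" "w \<bullet> cross3 a e = 0"
    using sq c assms(3) by (simp_all add: w_def inner_diff_left inner_add_left dot_cross_self)
  then have "cross3 w (cross3 a e) = 0" by (simp add: Lagrange)
  with w(3) have "w = 0" using norm_and_cross_eq_0[of w "cross3 a e"] n by auto
  then show q: "q = (q \<bullet> a) *\<^sub>R a + (q \<bullet> e) *\<^sub>R e + (q \<bullet> cross3 a e) *\<^sub>R cross3 a e"
    by (simp add: w_def)
  have "q \<bullet> q = ((q \<bullet> a) *\<^sub>R a + (q \<bullet> e) *\<^sub>R e + (q \<bullet> cross3 a e) *\<^sub>R cross3 a e) \<bullet> q"
    using arg_cong[OF q, of "\<lambda>x. x \<bullet> q"] .
  also have "\<dots> = (q \<bullet> a)\<^sup>2 + (q \<bullet> e)\<^sup>2 + (q \<bullet> cross3 a e)\<^sup>2"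
    by (simp add: inner_add_left inner_add_right power2_eq_square inner_commute)
  finally show "q \<bullet> q = (q \<bullet> a)\<^sup>2 + (q \<bullet> e)\<^sup>2 + (q \<bullet> cross3 a e)\<^sup>2" .
qed

lemma orthogonal_to_orthonormal_pair:
  fixes n p w :: "real^3"
  assumes "norm n = 1" "norm p = 1" "n \<bullet> p = 0" "w \<bullet> n = 0" "w \<bullet> p = 0"
  shows "w = (w \<bullet> cross3 n p) *\<^sub>R cross3 n p"
  using orthonormal_expansion(1)[OF assms(1-3), of w] assms(4,5) by simp

lemma linear_R2:
  fixes f :: "real^2 \<Rightarrow> 'b::real_vector"
  assumes "linear f"
  shows "f v = (v $ 1) *\<^sub>R f (axis 1 1) + (v $ 2) *\<^sub>R f (axis 2 1)"
proof -
  have "v = (v $ 1) *\<^sub>R axis 1 1 + (v $ 2) *\<^sub>R axis 2 1"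
    by (simp add: vec_eq_iff forall_2 axis_def)
  then have "f v = f ((v $ 1) *\<^sub>R axis 1 1 + (v $ 2) *\<^sub>R axis 2 1)" by simp
  then show ?thesis by (simp add: linear_add[OF assms] linear_cmul[OF assms])
qed

text \<open>
  Otherwise \<open>D\<close> would be injective from the plane into a line. For the derivative of an
  immersion into the product this says that the projection to the sphere has nonzero derivative.
\<close>
lemma injective_horizontal_part_nonzero:
  fixes D :: "real^2 \<Rightarrow> 'b::real_vector \<times> real"
  assumes "linear D" "inj D"
  obtains i where "fst (D (axis i 1)) \<noteq> 0"
proof (rule ccontr)
  assume "\<not> thesis"
  then have "fst (D (axis i 1)) = 0" for i using that by blast
  then have D: "D v = (0, v $ 1 * snd (D (axis 1 1)) + v $ 2 * snd (D (axis 2 1)))" for v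
    by (simp add: linear_R2[OF assms(1), of v] prod_eq_iff)
  define v :: "real^2" where "v = vector [snd (D (axis 2 1)), - snd (D (axis 1 1))]"
  have ker: "w = 0" if "D w = 0" for w
    using that assms linear_injective_0 by blast
  have "D v = 0" unfolding D[of v] by (simp add: v_def prod_eq_iff)
  then have "v = 0" by (rule ker)
  then have "snd (D (axis 1 1)) = 0"
    by (simp add: v_def vec_eq_iff forall_2)
  then have "D (axis 1 1) = 0" using \<open>\<And>i. fst (D (axis i 1)) = 0\<close> by (simp add: prod_eq_iff)
  then have "axis 1 (1::real) = (0::real^2)" by (rule ker)
  then show False by (simp add: axis_eq_0_iff)
qed


section \<open>Curvature of a cylinder over a spherical curve\<close>

text \<open>
  This is the trace formula for a cylinder: \<open>T\<close> is the unit tangent of the generating curve, so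
  the second form is \<open>\<kappa>\<close> times the square of the one-form \<open>\<theta>\<close>, while the first form is
  \<open>\<theta>\<otimes>\<theta> + \<zeta>\<otimes>\<zeta>\<close> with \<open>\<zeta>\<close> the vertical component. Thus one principal curvature is \<open>\<kappa>\<close> and the
  other, in the vertical direction, is zero.
\<close>
lemma mean_curvature_rank_one:
  fixes X :: "real^2 \<Rightarrow> (real^3) \<times> real"
  assumes lin: "linear (frechet_derivative X (at u))" and inj: "inj (frechet_derivative X (at u))"
    and T: "norm T = 1" and \<theta>: "\<And>i. fst (partial i X u) = \<theta> i *\<^sub>R T"
    and II: "\<And>i j. partial i (partial j X) u \<bullet> \<nu> = \<kappa> * (\<theta> i * \<theta> j)"
  shows "mean_curvature X \<nu> u = \<kappa> / 2"
proof -
  define \<zeta> where "\<zeta> i = snd (partial i X u)" for i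
  define \<delta> where "\<delta> = \<theta> 1 * \<zeta> 2 - \<theta> 2 * \<zeta> 1"
  let ?D = "frechet_derivative X (at u)"
  have D: "?D v = ((v $ 1 * \<theta> 1 + v $ 2 * \<theta> 2) *\<^sub>R T, v $ 1 * \<zeta> 1 + v $ 2 * \<zeta> 2)" for v
    using \<theta> by (simp add: linear_R2[OF lin, of v] prod_eq_iff \<zeta>_def scaleR_add_left)
  have ker: "v = 0" if "?D v = 0" for v
    using that inj linear_injective_0[OF lin] by blast
  have "\<delta> \<noteq> 0"
  proof
    assume "\<delta> = 0"
    then have "?D (vector [\<theta> 2, - \<theta> 1]) = 0" "?D (vector [\<zeta> 2, - \<zeta> 1]) = 0"
      by (simp_all add: D prod_eq_iff \<delta>_def mult.commute)
    then have "vector [\<theta> 2, - \<theta> 1] = (0::real^2)" "vector [\<zeta> 2, - \<zeta> 1] = (0::real^2)"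
      using ker by auto
    then have "\<theta> 1 = 0" "\<theta> 2 = 0" "\<zeta> 1 = 0" "\<zeta> 2 = 0"
      by (simp_all add: vec_eq_iff forall_2)
    then have "?D (axis 1 1) = 0" by (simp add: D prod_eq_iff)
    then show False using ker by (metis axis_eq_0_iff zero_neq_one)
  qed
  define I where "I = first_form X u"
  have I: "I $ i $ j = \<theta> i * \<theta> j + \<zeta> i * \<zeta> j" for i j
    using T by (simp add: I_def first_form_def inner_prod_def \<theta> \<zeta>_def norm_eq_1)
  have "det I = \<delta>\<^sup>2"
    by (simp add: det_2 I \<delta>_def power2_eq_square algebra_simps)
  then have "invertible I"
    using \<open>\<delta> \<noteq> 0\<close> by (simp add: invertible_det_nz)
  then have inv: "matrix_inv I ** I = mat 1"
    unfolding invertible_def matrix_inv_def by (rule someI2_ex) simp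
  \<comment> \<open>In the basis dual to \<open>\<theta>\<close>, \<open>\<zeta>\<close>, the vector \<open>w\<close> is the first one: the derivative of \<open>X\<close> maps it
    to the horizontal unit vector \<open>(T, 0)\<close>, whence the first form maps it to \<open>\<theta>\<close>.\<close>
  define w :: "2 \<Rightarrow> real" where "w i = (if i = 1 then \<zeta> 2 / \<delta> else - \<zeta> 1 / \<delta>)" for i
  have "\<theta> 1 * w 1 + \<theta> 2 * w 2 = \<delta> / \<delta>"
    by (simp add: w_def diff_divide_distrib[symmetric]) (simp add: \<delta>_def)
  then have w: "\<theta> 1 * w 1 + \<theta> 2 * w 2 = 1" "\<zeta> 1 * w 1 + \<zeta> 2 * w 2 = 0"
    using \<open>\<delta> \<noteq> 0\<close> by (simp_all add: w_def)
  define K :: "real^2^2" where "K = (\<chi> i j. \<kappa> * (w i * \<theta> j))"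
  have "second_form X \<nu> u = I ** K"
  proof -
    have "(I ** K) $ i $ j = \<kappa> * (\<theta> i * \<theta> j)" for i j
    proof -
      have "(I ** K) $ i $ j = \<kappa> * \<theta> j * (\<theta> i * (\<theta> 1 * w 1 + \<theta> 2 * w 2) + \<zeta> i * (\<zeta> 1 * w 1 + \<zeta> 2 * w 2))"
        by (simp add: matrix_matrix_mult_def K_def I sum_2 algebra_simps)
      then show ?thesis by (simp add: w)
    qed
    then show ?thesis by (simp add: vec_eq_iff second_form_def II)
  qed
  then have "matrix_inv I ** second_form X \<nu> u = K"
    by (simp add: matrix_mul_assoc inv)
  moreover have "trace K = \<kappa> * (\<theta> 1 * w 1 + \<theta> 2 * w 2)"
    by (simp add: trace_def sum_2 K_def algebra_simps)
  ultimately show ?thesis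
    by (simp add: mean_curvature_def I_def w)
qed

text \<open>
  A horizontal unit normal \<open>n\<close> confines all horizontal parts of tangent vectors, and the
  derivative of \<open>n\<close>, to the line spanned by \<open>T = n \<times> P\<close>, where \<open>P\<close> is the position in the sphere.
  So \<open>dP = \<theta> T\<close> and \<open>dn = \<omega> T\<close> with one-forms \<open>\<theta>\<close> and \<open>\<omega>\<close>, and the second form is
  \<open>- \<omega>\<otimes>\<theta>\<close>. It is symmetric because mixed partial derivatives commute, which forces
  \<open>\<omega> = - \<kappa> \<theta>\<close>: the normal changes only along the curve, not in the vertical direction.
\<close>
lemma cylinder_Weingarten:
  fixes X :: "real^2 \<Rightarrow> (real^3) \<times> real"
  assumes X: "Ck_on 2 X U" "open U" "u \<in> U" "X ` U \<subseteq> sphere 0 1 \<times> UNIV"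
    and inj: "inj (frechet_derivative X (at u))"
    and V: "open V" "u \<in> V" "V \<subseteq> U"
    and n: "\<And>x. x \<in> V \<Longrightarrow> norm (n x) = 1" "\<And>x. x \<in> V \<Longrightarrow> n x \<bullet> fst (X x) = 0"
      "\<And>x v. x \<in> V \<Longrightarrow> n x \<bullet> fst (frechet_derivative X (at x) v) = 0"
    and n': "(n has_derivative n') (at u)"
  obtains \<kappa> where "mean_curvature X (n u, 0) u = \<kappa> / 2"
    and "\<And>v. n' v = - \<kappa> *\<^sub>R fst (frechet_derivative X (at u) v)"
proof -
  let ?D = "frechet_derivative X (at u)"
  have ax: "axis i (1::real) \<in> Basis" for i :: 2 by simp
  have dX: "(X has_derivative frechet_derivative X (at x)) (at x)" if "x \<in> U" for x
    using Ck_on_2_derivatives(1)[OF X(1,2) that ax ax] .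
  have lin: "linear ?D" using dX[OF X(3)] has_derivative_linear by blast
  have dP: "((\<lambda>x. fst (X x)) has_derivative (\<lambda>v. fst (frechet_derivative X (at x) v))) (at x)" if "x \<in> U" for x
    using dX[OF that] by (rule has_derivative_fst)
  have dPj: "((\<lambda>x. fst (partial j X x)) has_derivative
      (\<lambda>v. fst (frechet_derivative (partial j X) (at u) v))) (at u)" for j
    using Ck_on_2_derivatives(2)[OF X(1-3) ax ax] by (rule has_derivative_fst)
  have P1: "fst (X x) \<bullet> fst (X x) = 1" if "x \<in> U" for x
    using X(4) that by (force simp: norm_eq_1)
  have PD: "fst (?D v) \<bullet> fst (X u) = 0" for v
    using inner_derivative_const[OF X(2,3) P1 dP[OF X(3)] dP[OF X(3)], of v] by (simp add: inner_commute)
  define T where "T = cross3 (n u) (fst (X u))"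
  have nP: "norm (n u) = 1" "norm (fst (X u)) = 1" "n u \<bullet> fst (X u) = 0"
    using n V P1[OF X(3)] by (auto simp: norm_eq_1)
  have T: "norm T = 1" unfolding T_def by (rule orthonormal_expansion(2)[OF nP])
  define \<theta> where "\<theta> i = fst (partial i X u) \<bullet> T" for i
  have \<theta>: "fst (partial i X u) = \<theta> i *\<^sub>R T" for i
    unfolding \<theta>_def T_def
    by (rule orthogonal_to_orthonormal_pair[OF nP])
       (use PD n(3)[OF V(2)] in \<open>auto simp: inner_commute\<close>)
  define \<omega> where "\<omega> i = n' (axis i 1) \<bullet> T" for i
  have \<omega>: "n' (axis i 1) = \<omega> i *\<^sub>R T" for i
    unfolding \<omega>_def T_def
  proof (rule orthogonal_to_orthonormal_pair[OF nP])
    have "n' (axis i 1) \<bullet> n u + n u \<bullet> n' (axis i 1) = 0"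
      by (rule inner_derivative_const[OF V(1,2) _ n' n', of 1]) (use n(1) in \<open>simp add: norm_eq_1\<close>)
    then show "n' (axis i 1) \<bullet> n u = 0" by (simp add: inner_commute)
    have "n' (axis i 1) \<bullet> fst (X u) + n u \<bullet> fst (?D (axis i 1)) = 0"
      by (rule inner_derivative_const[OF V(1,2) _ n' dP[OF X(3)], of 0]) (use n(2) in simp)
    then show "n' (axis i 1) \<bullet> fst (X u) = 0" using n(3)[OF V(2)] by simp
  qed
  have h: "partial i (partial j X) u \<bullet> (n u, 0) = - \<theta> j * \<omega> i" for i j
  proof -
    have "n' (axis i 1) \<bullet> fst (partial j X u) + n u \<bullet> fst (partial i (partial j X) u) = 0"
      by (rule inner_derivative_const[OF V(1,2) _ n' dPj[of j], where c = 0]) (use n(3) in simp)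
    then show ?thesis
      using T by (simp add: inner_prod_def \<omega> \<theta> norm_eq_1 inner_commute)
  qed
  have sym: "\<theta> 2 * \<omega> 1 = \<theta> 1 * \<omega> 2"
    using h[of 1 2] h[of 2 1] mixed_partials_commute[OF X(1-3) ax[of 1] ax[of 2]] by simp
  have nz: "\<theta> 1 \<noteq> 0 \<or> \<theta> 2 \<noteq> 0"
    using injective_horizontal_part_nonzero[OF lin inj] \<theta> by (metis exhaust_2 scaleR_zero_left)
  define \<kappa> where "\<kappa> = (if \<theta> 1 \<noteq> 0 then - \<omega> 1 / \<theta> 1 else - \<omega> 2 / \<theta> 2)"
  have 12: "\<omega> 1 = - \<kappa> * \<theta> 1" "\<omega> 2 = - \<kappa> * \<theta> 2"
    using sym nz by (auto simp: \<kappa>_def field_simps split: if_splits)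
  then have \<omega>\<theta>: "\<omega> i = - \<kappa> * \<theta> i" for i using exhaust_2[of i] by auto
  show ?thesis
  proof
    show "mean_curvature X (n u, 0) u = \<kappa> / 2"
      by (rule mean_curvature_rank_one[OF lin inj T \<theta>]) (simp add: h \<omega>\<theta>)
    have "linear n'" using n' has_derivative_linear by blast
    then show "n' v = - \<kappa> *\<^sub>R fst (?D v)" for v
      by (simp add: linear_R2[OF lin, of v] linear_R2[of n' v] \<omega> \<theta> \<omega>\<theta> algebra_simps)
  qed
qed


section \<open>Vertically invariant surfaces\<close>

lemma local_param_openin_image:
  assumes "local_param S F U \<phi>" "open V" "V \<subseteq> U"
  shows "openin (top_of_set S) (\<phi> ` V)"
proof -
  obtain \<psi> where h: "homeomorphism U (\<phi> ` U) \<phi> \<psi>" and o: "openin (top_of_set S) (\<phi> ` U)"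
    using assms unfolding local_param_def by blast
  have "openin (top_of_set U) V" using assms by (metis local_param_def openin_open_eq)
  then have "openin (top_of_set (\<phi> ` U)) (\<phi> ` V)"
    using homeomorphism_imp_open_map[OF h] by blast
  then show ?thesis using o openin_trans by blast
qed

text \<open>
  The vertical action only lifts to a continuous action on the surface, so its orbits need not be
  known to be differentiable in the chart. If \<open>dz\<close> had positive distance from the closed subspace
  \<open>range D\<close>, then the orbit of \<open>\<phi> u\<close>, seen in the chart as points \<open>y\<close> with
  \<open>F (\<phi> y) - F (\<phi> u) = t dz\<close>, would contradict the first-order expansion at \<open>u\<close>: injectivity
  of \<open>D\<close> bounds \<open>norm (y - u)\<close> by a multiple of \<open>t\<close>, so the error term is small compared
  with \<open>t\<close>.
\<close>
lemma vertical_tangent: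
  assumes inv: "vertically_invariant S F" and lp: "local_param S F U \<phi>" and u: "u \<in> U"
  shows "dz \<in> range (frechet_derivative (F \<circ> \<phi>) (at u))"
proof (rule ccontr)
  assume no: "dz \<notin> range (frechet_derivative (F \<circ> \<phi>) (at u))"
  define D where "D = frechet_derivative (F \<circ> \<phi>) (at u)"
  have U: "open U" "\<phi> ` U \<subseteq> S" "Ck_on 2 (F \<circ> \<phi>) U" "inj D"
    using lp u by (auto simp: local_param_def D_def)
  have ax: "axis i (1::real) \<in> Basis" for i :: 2 by simp
  have d: "((F \<circ> \<phi>) has_derivative D) (at u)"
    unfolding D_def using Ck_on_2_derivatives(1)[OF U(3,1) u ax ax] .
  then have lin: "linear D" using has_derivative_linear by blast
  obtain B where B: "B > 0" "\<And>w. B * norm w \<le> norm (D w)"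
    using linear_inj_bounded_below_pos[OF lin \<open>inj D\<close>] by blast
  have "closed (range D)"
    using linear_subspace_image[OF lin subspace_UNIV] by (rule closed_subspace)
  then obtain c where c: "c > 0" "\<And>w. c \<le> norm (dz - D w)"
    using separate_point_closed[of "range D" dz] no unfolding D_def[symmetric] dist_norm by blast
  \<comment> \<open>The first bound yields \<open>norm (y - u) \<le> 2 t / B\<close> below; with the second one the error is
    at most \<open>c t / 2\<close>.\<close>
  define \<epsilon> where "\<epsilon> = min (B / 2) (c * B / 4)"
  have "\<epsilon> > 0" using B c by (simp add: \<epsilon>_def)
  then obtain \<delta> where \<delta>: "\<delta> > 0"
    "\<And>y. norm (y - u) < \<delta> \<Longrightarrow> norm ((F \<circ> \<phi>) y - (F \<circ> \<phi>) u - D (y - u)) \<le> \<epsilon> * norm (y - u)"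
    using d unfolding has_derivative_at_alt by blast
  obtain \<tau> where \<tau>: "continuous_on (UNIV \<times> S) (\<lambda>(t, x). \<tau> t x)" "\<And>x. x \<in> S \<Longrightarrow> \<tau> 0 x = x"
    "\<And>t x. x \<in> S \<Longrightarrow> \<tau> t x \<in> S" "\<And>t x. x \<in> S \<Longrightarrow> F (\<tau> t x) = vtrans t (F x)"
    using inv unfolding vertically_invariant_def by metis
  have x: "\<phi> u \<in> S" using U u by blast
  let ?V = "U \<inter> ball u \<delta>"
  have op: "openin (top_of_set S) (\<phi> ` ?V)"
    using U \<delta> by (intro local_param_openin_image[OF lp]) auto
  have "continuous_on UNIV ((\<lambda>(t, x). \<tau> t x) \<circ> (\<lambda>t. (t, \<phi> u)))"
    by (rule continuous_on_compose) (use x in \<open>auto intro!: continuous_intros continuous_on_subset[OF \<tau>(1)]\<close>)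
  then have "continuous_on UNIV (\<lambda>t. \<tau> t (\<phi> u))" by (simp add: o_def)
  then have "open ((\<lambda>t. \<tau> t (\<phi> u)) -` (\<phi> ` ?V))"
    using continuous_openin_preimage[OF _ _ op, of UNIV "\<lambda>t. \<tau> t (\<phi> u)"] \<tau>(3) x
    by (auto simp: Pi_iff)
  moreover have "0 \<in> (\<lambda>t. \<tau> t (\<phi> u)) -` (\<phi> ` ?V)"
    using \<tau>(2)[OF x] u \<delta> by auto
  ultimately obtain r where r: "r > 0" "ball 0 r \<subseteq> (\<lambda>t. \<tau> t (\<phi> u)) -` (\<phi> ` ?V)"
    using openE by blast
  define t where "t = r / 2"
  have t: "t > 0" "t \<in> ball 0 r" using r by (auto simp: t_def)
  then obtain y where y: "y \<in> ?V" "\<tau> t (\<phi> u) = \<phi> y" using r by blast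
  have "(F \<circ> \<phi>) y - (F \<circ> \<phi>) u = t *\<^sub>R dz"
    using \<tau>(4)[OF x, of t] y(2) by (simp add: vtrans_def dz_def prod_eq_iff)
  moreover have "norm (y - u) < \<delta>" using y by (simp add: dist_norm norm_minus_commute)
  ultimately have le: "norm (t *\<^sub>R dz - D (y - u)) \<le> \<epsilon> * norm (y - u)" using \<delta>(2) by metis
  have "t *\<^sub>R dz - D (y - u) = t *\<^sub>R (dz - D ((1 / t) *\<^sub>R (y - u)))"
    using t unfolding linear_cmul[OF lin] scaleR_diff_right[of t dz] by simp
  then have ge: "c * t \<le> norm (t *\<^sub>R dz - D (y - u))"
    using c(2)[of "(1 / t) *\<^sub>R (y - u)"] t by (simp add: mult.commute)
  have "norm (D (y - u)) \<le> norm (t *\<^sub>R dz) + norm (t *\<^sub>R dz - D (y - u))"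
    by (metis norm_minus_commute norm_triangle_sub)
  moreover have "norm (t *\<^sub>R dz) = t" using t by (simp add: dz_def norm_Pair)
  ultimately have "B * norm (y - u) \<le> t + \<epsilon> * norm (y - u)"
    using B(2)[of "y - u"] le by linarith
  moreover have "\<epsilon> * norm (y - u) \<le> B / 2 * norm (y - u)"
    by (intro mult_right_mono) (auto simp: \<epsilon>_def)
  ultimately have yt: "norm (y - u) \<le> 2 * t / B" using B(1) by (simp add: field_simps)
  have "c * t \<le> \<epsilon> * norm (y - u)" using le ge by linarith
  also have "\<dots> \<le> (c * B / 4) * (2 * t / B)"
    using yt B c t \<open>\<epsilon> > 0\<close> by (intro mult_mono) (auto simp: \<epsilon>_def)
  also have "\<dots> = c * t / 2" using B by simp
  finally show False using c t by simp
qed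

locale vertical_surface =
  fixes S :: "'a::t2_space set" and F N :: "'a \<Rightarrow> (real^3) \<times> real"
  assumes immersed: "immersed_surface S F"
    and normal: "unit_normal S F N"
    and invariant: "vertically_invariant S F"
begin

lemma chart:
  assumes "x \<in> S"
  obtains U \<phi> u where "local_param S F U \<phi>" "u \<in> U" "\<phi> u = x"
proof -
  have "\<exists>U \<phi>. local_param S F U \<phi> \<and> x \<in> \<phi> ` U"
    using assms immersed unfolding immersed_surface_def by simp
  then show ?thesis using that by (elim exE conjE imageE) simp
qed

lemma position: "x \<in> S \<Longrightarrow> norm (fst (F x)) = 1"
proof -
  assume "x \<in> S"
  then have "F x \<in> sphere 0 1 \<times> UNIV" using immersed unfolding immersed_surface_def by blast
  then show ?thesis by (auto simp: mem_Times_iff)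
qed

lemma chart_facts:
  assumes lp: "local_param S F U \<phi>"
  shows "open U" "Ck_on 2 (F \<circ> \<phi>) U" "(F \<circ> \<phi>) ` U \<subseteq> sphere 0 1 \<times> UNIV" "continuous_on U \<phi>"
    and "u \<in> U \<Longrightarrow> \<phi> u \<in> S"
    and "u \<in> U \<Longrightarrow> inj (frechet_derivative (F \<circ> \<phi>) (at u))"
    and "u \<in> U \<Longrightarrow> ((F \<circ> \<phi>) has_derivative frechet_derivative (F \<circ> \<phi>) (at u)) (at u)"
    and "u \<in> U \<Longrightarrow> linear (frechet_derivative (F \<circ> \<phi>) (at u))"
proof -
  show U: "open U" and C: "Ck_on 2 (F \<circ> \<phi>) U" and c: "continuous_on U \<phi>"
    and S: "u \<in> U \<Longrightarrow> \<phi> u \<in> S" for u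
    using lp unfolding local_param_def homeomorphism_def by blast+
  show "(F \<circ> \<phi>) ` U \<subseteq> sphere 0 1 \<times> UNIV"
    using position S by (simp add: image_subset_iff mem_Times_iff)
  show "u \<in> U \<Longrightarrow> inj (frechet_derivative (F \<circ> \<phi>) (at u))"
    using lp unfolding local_param_def by auto
  have ax: "axis i (1::real) \<in> Basis" for i :: 2 by simp
  show d: "u \<in> U \<Longrightarrow> ((F \<circ> \<phi>) has_derivative frechet_derivative (F \<circ> \<phi>) (at u)) (at u)"
    using Ck_on_2_derivatives(1)[OF C U _ ax ax] .
  then show "u \<in> U \<Longrightarrow> linear (frechet_derivative (F \<circ> \<phi>) (at u))"
    using has_derivative_linear by blast
qed

lemma normal_horizontal:
  assumes "x \<in> S"
  shows "N x = (fst (N x), 0)" "norm (fst (N x)) = 1" "fst (N x) \<bullet> fst (F x) = 0"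
proof -
  obtain U \<phi> u where lp: "local_param S F U \<phi>" "u \<in> U" "\<phi> u = x" using chart[OF assms] .
  obtain \<xi> where "frechet_derivative (F \<circ> \<phi>) (at u) \<xi> = dz"
    using vertical_tangent[OF invariant lp(1,2)] by (metis imageE)
  moreover have "N (\<phi> u) \<bullet> frechet_derivative (F \<circ> \<phi>) (at u) \<xi> = 0"
    using normal lp(1,2) unfolding unit_normal_def by blast
  ultimately have "N x \<bullet> dz = 0" using lp(3) by simp
  then have N: "snd (N x) = 0" by (simp add: dz_def inner_prod_def)
  then show "N x = (fst (N x), 0)" by (simp add: prod_eq_iff)
  have "norm (N x) = 1" and "fst (N x) \<bullet> fst (F x) = 0"
    using normal assms unfolding unit_normal_def by blast+
  then show "norm (fst (N x)) = 1" "fst (N x) \<bullet> fst (F x) = 0"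
    using N by (simp_all add: norm_prod_def)
qed

lemma normal_tangent_orthogonal:
  assumes "local_param S F U \<phi>" "u \<in> U"
  shows "fst (N (\<phi> u)) \<bullet> fst (frechet_derivative (F \<circ> \<phi>) (at u) v) = 0"
proof -
  have "N (\<phi> u) \<bullet> frechet_derivative (F \<circ> \<phi>) (at u) v = 0"
    using normal assms unfolding unit_normal_def by blast
  moreover have "snd (N (\<phi> u)) = 0"
    using arg_cong[OF normal_horizontal(1)[OF chart_facts(5)[OF assms]], of snd] by simp
  ultimately show ?thesis by (simp add: inner_prod_def)
qed

lemma position_tangent_orthogonal:
  assumes lp: "local_param S F U \<phi>" "u \<in> U"
  shows "fst (frechet_derivative (F \<circ> \<phi>) (at u) v) \<bullet> fst (F (\<phi> u)) = 0"
proof -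
  have "fst (frechet_derivative (F \<circ> \<phi>) (at u) v) \<bullet> fst ((F \<circ> \<phi>) u)
      + fst ((F \<circ> \<phi>) u) \<bullet> fst (frechet_derivative (F \<circ> \<phi>) (at u) v) = 0"
    by (rule inner_derivative_const[OF chart_facts(1)[OF lp(1)] lp(2) _
          has_derivative_fst[OF chart_facts(7)[OF lp]] has_derivative_fst[OF chart_facts(7)[OF lp]], where c = 1])
       (use position chart_facts(5)[OF lp(1)] in \<open>auto simp: norm_eq_1\<close>)
  then show ?thesis by (simp add: inner_commute)
qed

text \<open>
  The definition of a unit normal only asks for continuity. Near \<open>u\<close> the normal is \<open>\<plusminus>m\<close>, where \<open>m\<close>
  is the normalized cross product of the position and a nonvanishing tangent vector \<open>W\<close>; \<open>m\<close> is
  differentiable, and by continuity the sign is constant on a ball.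
\<close>
lemma normal_differentiable:
  assumes lp: "local_param S F U \<phi>" "u \<in> U"
  obtains r where "r > 0" "ball u r \<subseteq> U"
    "\<And>x. x \<in> ball u r \<Longrightarrow> (\<lambda>x. fst (N (\<phi> x))) differentiable (at x)"
proof -
  let ?X = "F \<circ> \<phi>"
  define n where "n x = fst (N (\<phi> x))" for x
  define P where "P x = fst (?X x)" for x
  note facts = chart_facts[OF lp(1)]
  obtain i where i: "fst (partial i ?X u) \<noteq> 0"
    using injective_horizontal_part_nonzero[OF facts(8,6)] lp(2) by blast
  define W where "W x = fst (partial i ?X x)" for x
  have ax: "axis i (1::real) \<in> Basis" for i :: 2 by simp
  have dW: "W differentiable (at x)" if "x \<in> U" for x
    unfolding W_def using has_derivative_fst[OF Ck_on_2_derivatives(2)[OF facts(2,1) that ax ax]]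
    by (rule differentiableI)
  have dP: "P differentiable (at x)" if "x \<in> U" for x
    unfolding P_def using has_derivative_fst[OF facts(7)[OF that]] by (rule differentiableI)
  have cW: "continuous_on U W"
    using dW differentiable_imp_continuous_within continuous_at_imp_continuous_on by blast
  have "open (U \<inter> W -` (- {0}))"
    by (rule continuous_open_preimage[OF cW facts(1)]) auto
  moreover have "u \<in> U \<inter> W -` (- {0})" using i lp by (simp add: W_def)
  ultimately obtain r where r: "r > 0" "ball u r \<subseteq> U \<inter> W -` (- {0})"
    using openE by blast
  define m where "m x = inverse (norm (W x)) *\<^sub>R cross3 (P x) (W x)" for x
  have bb: "bounded_bilinear cross3"
    using bilinear_cross bilinear_conv_bounded_bilinear by blast
  have dm: "m differentiable (at x)" if x: "x \<in> ball u r" for x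
  proof -
    have xU: "x \<in> U" and W0: "W x \<noteq> 0" using r x by auto
    have "(\<lambda>x. cross3 (P x) (W x)) differentiable (at x)"
      using dP[OF xU] dW[OF xU] bounded_bilinear.FDERIV[OF bb] unfolding differentiable_def by blast
    moreover have "(\<lambda>x. inverse (norm (W x))) differentiable (at x)"
      using differentiable_compose[OF _ dW[OF xU], of norm] differentiable_norm_at[OF W0] W0
      by (intro differentiable_inverse) auto
    ultimately show ?thesis unfolding m_def by (intro differentiable_scaleR)
  qed
  have nm: "norm (m x) = 1" "n x = (n x \<bullet> m x) *\<^sub>R m x" if x: "x \<in> ball u r" for x
  proof -
    have xU: "x \<in> U" and W0: "W x \<noteq> 0" using r x by auto
    define T where "T = inverse (norm (W x)) *\<^sub>R W x"
    have T: "norm (P x) = 1" "norm T = 1" "P x \<bullet> T = 0" and mT: "m x = cross3 (P x) T"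
      using W0 position facts(5)[OF xU] position_tangent_orthogonal[OF lp(1) xU]
      by (auto simp: T_def P_def W_def m_def cross_mult_right inner_commute)
    show "norm (m x) = 1" unfolding mT by (rule orthonormal_expansion(2)[OF T])
    show "n x = (n x \<bullet> m x) *\<^sub>R m x"
      unfolding mT
      by (rule orthogonal_to_orthonormal_pair[OF T])
         (use normal_horizontal(3)[OF facts(5)[OF xU]] normal_tangent_orthogonal[OF lp(1) xU]
          in \<open>auto simp: n_def P_def T_def W_def\<close>)
  qed
  have eps: "n x \<bullet> m x \<in> {1, -1}" if x: "x \<in> ball u r" for x
  proof -
    have "norm (n x) = 1" using normal_horizontal(2) facts(5) r x by (auto simp: n_def)
    moreover have "norm (n x) = \<bar>n x \<bullet> m x\<bar>"
      using arg_cong[OF nm(2)[OF x], of norm] nm(1)[OF x] by simp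
    ultimately show ?thesis by auto
  qed
  have cN: "continuous_on S N" using normal unfolding unit_normal_def by blast
  have "continuous_on U (\<lambda>x. N (\<phi> x))"
    by (rule continuous_on_compose2[OF cN facts(4)]) (use facts(5) in auto)
  then have "continuous_on (ball u r) n"
    unfolding n_def using r(2) by (intro continuous_on_fst) (auto intro: continuous_on_subset)
  moreover have "continuous_on (ball u r) m"
    using dm differentiable_imp_continuous_within continuous_at_imp_continuous_on by blast
  ultimately have "continuous_on (ball u r) (\<lambda>x. n x \<bullet> m x)" by (rule continuous_on_inner)
  moreover have "finite ((\<lambda>x. n x \<bullet> m x) ` ball u r)"
    by (rule finite_subset[of _ "{1, -1}"], rule image_subsetI, rule eps) auto
  ultimately have "(\<lambda>x. n x \<bullet> m x) constant_on ball u r"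
    using continuous_finite_range_constant[OF connected_ball] by blast
  then obtain \<epsilon> where "\<And>x. x \<in> ball u r \<Longrightarrow> n x \<bullet> m x = \<epsilon>"
    unfolding constant_on_def by blast
  with nm(2) have n: "n x = \<epsilon> *\<^sub>R m x" if "x \<in> ball u r" for x using that by metis
  show ?thesis
  proof
    show "r > 0" "ball u r \<subseteq> U" using r by auto
    fix x assume x: "x \<in> ball u r"
    have "(\<lambda>x. \<epsilon> *\<^sub>R m x) differentiable (at x)"
      using dm[OF x] by (intro differentiable_scaleR) auto
    then obtain m' where "((\<lambda>x. \<epsilon> *\<^sub>R m x) has_derivative m') (at x)" unfolding differentiable_def by blast
    then have "(n has_derivative m') (at x)"
      by (rule has_derivative_transform_within_open[OF _ open_ball x]) (simp add: n)
    then show "(\<lambda>x. fst (N (\<phi> x))) differentiable (at x)"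
      unfolding n_def by (rule differentiableI)
  qed
qed

text \<open>
  On a cylinder the translator equation reads \<open>\<kappa> = 2 \<Lambda>\<close>, since the normal is horizontal. With
  \<open>dn = - \<kappa> dP\<close> the map \<open>2 \<Lambda> P + n\<close> has zero derivative.
\<close>
lemma translator_derivative_eq_0:
  assumes tr: "translator S F N \<Lambda>" and lp: "local_param S F U \<phi>" "u \<in> U"
    and r: "r > 0" "ball u r \<subseteq> U"
      "\<And>x. x \<in> ball u r \<Longrightarrow> (\<lambda>x. fst (N (\<phi> x))) differentiable (at x)"
    and x: "x \<in> ball u r"
  shows "((\<lambda>x. (2 * \<Lambda>) *\<^sub>R fst (F (\<phi> x)) + fst (N (\<phi> x))) has_derivative (\<lambda>v. 0)) (at x)"
proof -
  let ?X = "F \<circ> \<phi>"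
  note facts = chart_facts[OF lp(1)]
  have xU: "x \<in> U" using r x by blast
  obtain n' where n': "((\<lambda>x. fst (N (\<phi> x))) has_derivative n') (at x)"
    using r(3)[OF x] unfolding differentiable_def by blast
  have nf: "norm (fst (N (\<phi> y))) = 1" "fst (N (\<phi> y)) \<bullet> fst (?X y) = 0"
    "fst (N (\<phi> y)) \<bullet> fst (frechet_derivative ?X (at y) v) = 0" if "y \<in> ball u r" for y v
    using normal_horizontal(2,3)[OF facts(5)] normal_tangent_orthogonal[OF lp(1)] r that by auto
  obtain \<kappa> where \<kappa>: "mean_curvature ?X (fst (N (\<phi> x)), 0) x = \<kappa> / 2"
    "\<And>v. n' v = - \<kappa> *\<^sub>R fst (frechet_derivative ?X (at x) v)"
    by (rule cylinder_Weingarten[OF facts(2,1) xU facts(3) facts(6)[OF xU] open_ball x r(2) nf n']) auto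
  have "mean_curvature ?X (N (\<phi> x)) x = N (\<phi> x) \<bullet> dz + \<Lambda>"
    using tr lp xU unfolding translator_def by blast
  then have "\<kappa> = 2 * \<Lambda>"
    using \<kappa>(1) normal_horizontal(1)[OF facts(5)[OF xU]] by (simp add: dz_def inner_prod_def prod_eq_iff)
  with \<kappa>(2) have "(2 * \<Lambda>) *\<^sub>R fst (frechet_derivative ?X (at x) v) + n' v = 0" for v by simp
  moreover have "((\<lambda>x. (2 * \<Lambda>) *\<^sub>R fst (?X x) + fst (N (\<phi> x))) has_derivative
      (\<lambda>v. (2 * \<Lambda>) *\<^sub>R fst (frechet_derivative ?X (at x) v) + n' v)) (at x)"
    by (intro has_derivative_add has_derivative_scaleR_right has_derivative_fst facts(7)[OF xU] n')
  ultimately show ?thesis by simp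
qed

lemma translator_constant:
  assumes tr: "translator S F N \<Lambda>" and "connected S"
  shows "(\<lambda>x. (2 * \<Lambda>) *\<^sub>R fst (F x) + fst (N x)) constant_on S"
proof (rule locally_constant_imp_constant[OF \<open>connected S\<close>])
  fix x assume "x \<in> S"
  then obtain U \<phi> u where lp: "local_param S F U \<phi>" "u \<in> U" "\<phi> u = x" by (rule chart)
  obtain r where r: "r > 0" "ball u r \<subseteq> U"
    "\<And>x. x \<in> ball u r \<Longrightarrow> (\<lambda>x. fst (N (\<phi> x))) differentiable (at x)"
    using normal_differentiable[OF lp(1,2)] by blast
  let ?G = "\<lambda>x. (2 * \<Lambda>) *\<^sub>R fst (F x) + fst (N x)"
  have "?G (\<phi> y) = ?G (\<phi> u)" if "y \<in> ball u r" for y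
    using has_derivative_zero_unique_connected[OF open_ball connected_ball
        translator_derivative_eq_0[OF tr lp(1,2) r] that, of u] r(1) by simp
  then show "\<exists>T. openin (top_of_set S) T \<and> x \<in> T \<and> (\<forall>y\<in>T. ?G y = ?G x)"
    using local_param_openin_image[OF lp(1) open_ball r(2)] r(1) lp(3)
    by (intro exI[of _ "\<phi> ` ball u r"]) auto
qed

text \<open>
  The constant vector \<open>A = 2 \<Lambda> P + n\<close> has norm \<open>sqrt (4 \<Lambda>\<^sup>2 + 1)\<close> and \<open>P \<bullet> A = 2 \<Lambda>\<close>. So \<open>P\<close> stays in
  the plane section of the sphere with unit axis \<open>a = A / norm A\<close> and height \<open>d = 2 \<Lambda> / norm A\<close>;
  here \<open>\<mu> = norm A\<close>.
\<close>
lemma translator_in_circle: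
  assumes tr: "translator S F N \<Lambda>" and "connected S"
  obtains a d \<mu> where "norm a = 1" "\<bar>d\<bar> < 1" "\<mu> * d = 2 * \<Lambda>"
    "\<And>x. x \<in> S \<Longrightarrow> fst (F x) \<bullet> a = d"
    "\<And>x. x \<in> S \<Longrightarrow> fst (N x) = \<mu> *\<^sub>R (a - d *\<^sub>R fst (F x))"
proof -
  obtain A where A: "\<And>x. x \<in> S \<Longrightarrow> (2 * \<Lambda>) *\<^sub>R fst (F x) + fst (N x) = A"
    using translator_constant[OF assms] unfolding constant_on_def by blast
  obtain x0 where x0: "x0 \<in> S" using immersed unfolding immersed_surface_def by blast
  have "A \<bullet> A = (2 * \<Lambda>)\<^sup>2 + 1"
    using normal_horizontal(2,3)[OF x0] position[OF x0]
    by (simp add: A[OF x0, symmetric] inner_add_left inner_add_right norm_eq_1 inner_commute power2_eq_square)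
  then have A2: "(norm A)\<^sup>2 = (2 * \<Lambda>)\<^sup>2 + 1" by (simp add: power2_norm_eq_inner)
  have "(norm A)\<^sup>2 > 0" unfolding A2 by (rule add_nonneg_pos) auto
  then have pos: "norm A > 0" by simp
  have "\<bar>2 * \<Lambda>\<bar>\<^sup>2 < (norm A)\<^sup>2" unfolding A2 power2_abs by simp
  then have lt: "\<bar>2 * \<Lambda>\<bar> < norm A" by (rule power2_less_imp_less) simp
  show ?thesis
  proof
    show "norm (A /\<^sub>R norm A) = 1" "norm A * (2 * \<Lambda> / norm A) = 2 * \<Lambda>" using pos by auto
    show "\<bar>2 * \<Lambda> / norm A\<bar> < 1" using lt pos by (simp add: abs_divide)
    fix x assume x: "x \<in> S"
    have "fst (F x) \<bullet> A = 2 * \<Lambda>"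
      using normal_horizontal(3)[OF x] position[OF x]
      by (simp add: A[OF x, symmetric] inner_add_right norm_eq_1 inner_commute)
    then show "fst (F x) \<bullet> (A /\<^sub>R norm A) = 2 * \<Lambda> / norm A" by (simp add: divide_inverse mult.commute)
    have "norm A *\<^sub>R (A /\<^sub>R norm A - (2 * \<Lambda> / norm A) *\<^sub>R fst (F x)) = A - (2 * \<Lambda>) *\<^sub>R fst (F x)"
      using pos by (simp add: scaleR_diff_right)
    then show "fst (N x) = norm A *\<^sub>R (A /\<^sub>R norm A - (2 * \<Lambda> / norm A) *\<^sub>R fst (F x))"
      using A[OF x] by (metis add_diff_cancel_left')
  qed
qed

text \<open>
  The normal and \<open>a - d p\<close> are both orthogonal to the position \<open>p\<close> and to the unit tangent \<open>T\<close> of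
  the circle, hence multiples of \<open>p \<times> T\<close>.
\<close>
lemma circle_normal:
  assumes a: "norm a = 1" "\<bar>d\<bar> < 1" and on: "\<And>x. x \<in> S \<Longrightarrow> fst (F x) \<bullet> a = d" and x: "x \<in> S"
  obtains \<mu> where "fst (N x) = \<mu> *\<^sub>R (a - d *\<^sub>R fst (F x))"
proof -
  obtain U \<phi> u where lp: "local_param S F U \<phi>" "u \<in> U" "\<phi> u = x" using chart[OF x] .
  let ?X = "F \<circ> \<phi>" and ?D = "frechet_derivative (F \<circ> \<phi>) (at u)"
  note facts = chart_facts[OF lp(1)]
  obtain i where i: "fst (partial i ?X u) \<noteq> 0"
    using injective_horizontal_part_nonzero[OF facts(8,6)] lp(2) by blast
  define T where "T = inverse (norm (fst (partial i ?X u))) *\<^sub>R fst (partial i ?X u)"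
  define p where "p = fst (F x)"
  have T: "norm p = 1" "norm T = 1" "p \<bullet> T = 0"
    using i position[OF x] position_tangent_orthogonal[OF lp(1,2)] lp(3)
    by (auto simp: T_def p_def inner_commute)
  have "fst (partial i ?X u) \<bullet> a + fst (?X u) \<bullet> 0 = 0"
    by (rule inner_derivative_const[OF facts(1) lp(2) _ has_derivative_fst[OF facts(7)[OF lp(2)]]
          has_derivative_const, of a d])
       (use on facts(5) in auto)
  then have Ta: "T \<bullet> a = 0" by (simp add: T_def)
  have n: "fst (N x) \<bullet> p = 0" "fst (N x) \<bullet> T = 0"
    using normal_horizontal(3)[OF x] normal_tangent_orthogonal[OF lp(1,2)] lp(3)
    by (auto simp: p_def T_def)
  define b where "b = a - d *\<^sub>R p"
  define q where "q = cross3 p T"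
  have pa: "p \<bullet> a = d" "a \<bullet> a = 1" "p \<bullet> p = 1" using on[OF x] a T by (auto simp: p_def norm_eq_1)
  have b: "b \<bullet> p = 0" "b \<bullet> T = 0"
    using pa Ta T(3) by (simp_all add: b_def inner_diff_left inner_diff_right inner_commute)
  have eqs: "fst (N x) = (fst (N x) \<bullet> q) *\<^sub>R q" "b = (b \<bullet> q) *\<^sub>R q"
    unfolding q_def by (rule orthogonal_to_orthonormal_pair[OF T n], rule orthogonal_to_orthonormal_pair[OF T b])
  have "b \<bullet> b = 1 - d\<^sup>2"
    using pa by (simp add: b_def inner_diff_left inner_diff_right inner_commute power2_eq_square)
  moreover have "d\<^sup>2 < 1" using a(2) by (simp add: abs_square_less_1)
  ultimately have "b \<noteq> 0" by auto
  then have "b \<bullet> q \<noteq> 0" using eqs(2) by auto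
  then have "q = inverse (b \<bullet> q) *\<^sub>R b" using eqs(2) by (metis scaleR_scaleR left_inverse scaleR_one)
  then have "fst (N x) = (fst (N x) \<bullet> q * inverse (b \<bullet> q)) *\<^sub>R b"
    using eqs(1) by (metis scaleR_scaleR)
  then show ?thesis using that unfolding b_def p_def by blast
qed

text \<open>
  Differentiating \<open>P \<bullet> a = d\<close> and \<open>P \<bullet> P = 1\<close> twice gives \<open>P\<^sub>i\<^sub>j \<bullet> a = 0\<close> and
  \<open>P\<^sub>i\<^sub>j \<bullet> P = - P\<^sub>i \<bullet> P\<^sub>j\<close>, so the second form with respect to \<open>\<mu> (a - d P)\<close> is
  \<open>\<mu> d\<close> times the first form of the projection \<open>P\<close>.
\<close>
lemma circle_mean_curvature:
  assumes on: "\<And>x. x \<in> S \<Longrightarrow> fst (F x) \<bullet> a = d" and lp: "local_param S F U \<phi>" "u \<in> U"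
    and \<mu>: "fst (N (\<phi> u)) = \<mu> *\<^sub>R (a - d *\<^sub>R fst (F (\<phi> u)))"
  shows "mean_curvature (F \<circ> \<phi>) (N (\<phi> u)) u = \<mu> * d / 2"
proof -
  let ?X = "F \<circ> \<phi>"
  note facts = chart_facts[OF lp(1)]
  have x: "\<phi> u \<in> S" using facts(5) lp by blast
  have ax: "axis i (1::real) \<in> Basis" for i :: 2 by simp
  have dP: "((\<lambda>x. fst (?X x)) has_derivative (\<lambda>v. fst (frechet_derivative ?X (at y) v))) (at y)" if "y \<in> U" for y
    using facts(7)[OF that] by (rule has_derivative_fst)
  have dPj: "((\<lambda>x. fst (partial j ?X x)) has_derivative
      (\<lambda>v. fst (frechet_derivative (partial j ?X) (at u) v))) (at u)" for j
    using Ck_on_2_derivatives(2)[OF facts(2,1) lp(2) ax ax] by (rule has_derivative_fst)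
  have a1: "fst (partial j ?X y) \<bullet> a = 0" if "y \<in> U" for j y
  proof -
    have "fst (partial j ?X y) \<bullet> a + fst (?X y) \<bullet> 0 = 0"
      by (rule inner_derivative_const[OF facts(1) that _ dP[OF that] has_derivative_const, of a d])
         (use on facts(5) in auto)
    then show ?thesis by simp
  qed
  have a2: "fst (partial i (partial j ?X) u) \<bullet> a = 0" for i j
  proof -
    have "fst (partial i (partial j ?X) u) \<bullet> a + fst (partial j ?X u) \<bullet> 0 = 0"
      by (rule inner_derivative_const[OF facts(1) lp(2) _ dPj has_derivative_const, of j a 0])
         (use a1 in auto)
    then show ?thesis by simp
  qed
  have p2: "fst (partial i (partial j ?X) u) \<bullet> fst (?X u) + fst (partial j ?X u) \<bullet> fst (partial i ?X u) = 0" for i j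
    by (rule inner_derivative_const[OF facts(1) lp(2) _ dPj dP[OF lp(2)], of j 0])
       (use position_tangent_orthogonal[OF lp(1)] in auto)
  have nP: "norm (fst (N (\<phi> u))) = 1" "norm (fst (F (\<phi> u))) = 1" "fst (N (\<phi> u)) \<bullet> fst (F (\<phi> u)) = 0"
    using normal_horizontal(2,3)[OF x] position[OF x] by auto
  define T where "T = cross3 (fst (N (\<phi> u))) (fst (F (\<phi> u)))"
  have T: "norm T = 1" unfolding T_def by (rule orthonormal_expansion(2)[OF nP])
  have \<theta>: "fst (partial i ?X u) = (fst (partial i ?X u) \<bullet> T) *\<^sub>R T" for i
    unfolding T_def
    by (rule orthogonal_to_orthonormal_pair[OF nP])
       (use position_tangent_orthogonal[OF lp] normal_tangent_orthogonal[OF lp] in \<open>auto simp: inner_commute\<close>)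
  show ?thesis
  proof (rule mean_curvature_rank_one[OF facts(8)[OF lp(2)] facts(6)[OF lp(2)] T \<theta>])
    fix i j
    have "partial i (partial j ?X) u \<bullet> N (\<phi> u) = fst (partial i (partial j ?X) u) \<bullet> fst (N (\<phi> u))"
      by (subst normal_horizontal(1)[OF x]) (simp add: inner_prod_def)
    also have "\<dots> = \<mu> * d * (fst (partial i ?X u) \<bullet> fst (partial j ?X u))"
    proof -
      have "fst (partial i (partial j ?X) u) \<bullet> fst (F (\<phi> u)) = - (fst (partial i ?X u) \<bullet> fst (partial j ?X u))"
        using p2[where i = i and j = j] by (simp add: inner_commute)
      then show ?thesis
        using a2[where i = i and j = j] by (simp add: \<mu> inner_diff_right)
    qed
    also have "fst (partial i ?X u) \<bullet> fst (partial j ?X u) = (fst (partial i ?X u) \<bullet> T) * (fst (partial j ?X u) \<bullet> T)"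
      using arg_cong[OF \<theta>[of i], of "\<lambda>w. w \<bullet> fst (partial j ?X u)"] by (simp add: inner_commute)
    finally show "partial i (partial j ?X) u \<bullet> N (\<phi> u)
      = \<mu> * d * ((fst (partial i ?X u) \<bullet> T) * (fst (partial j ?X u) \<bullet> T))" .
  qed
qed

end


section \<open>Circles of the sphere\<close>

text \<open>
  The computation for curves in a circle is the one for surfaces over it: \<open>c'' \<bullet> a = 0\<close>
  and \<open>c'' \<bullet> c = - c' \<bullet> c'\<close>. The value is the same for all regular curves in the circle,
  whatever their parametrization.
\<close>
lemma geodesic_curvature_in_circle:
  assumes reg: "regular_curve_in C c I" and C: "C \<subseteq> {p \<in> sphere 0 1. p \<bullet> a = d}" and s: "s \<in> I"
  shows "geodesic_curvature c (\<mu> *\<^sub>R (a - d *\<^sub>R c s)) s = \<mu> * d"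
proof -
  have I: "open I" "Ck_on 2 c I" "\<And>t. t \<in> I \<Longrightarrow> c t \<in> C" "\<And>t. t \<in> I \<Longrightarrow> vector_derivative c (at t) \<noteq> 0"
    using reg unfolding regular_curve_in_def by auto
  define c' where "c' t = vector_derivative c (at t)" for t
  define E where "E = frechet_derivative (\<lambda>t. frechet_derivative c (at t) 1) (at s)"
  have dc: "(c has_derivative frechet_derivative c (at t)) (at t)" if "t \<in> I" for t
    using Ck_on_2_derivatives(1)[OF I(2,1) that, of 1 1] by simp
  have c'1: "frechet_derivative c (at t) 1 = c' t" if "t \<in> I" for t
    using dc[OF that] frechet_derivative_eq_vector_derivative[of c t]
    unfolding c'_def by (metis differentiableI scaleR_one)
  have "((\<lambda>t. frechet_derivative c (at t) 1) has_derivative E) (at s)"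
    unfolding E_def using Ck_on_2_derivatives(2)[OF I(2,1) s, of 1 1] by simp
  then have dc': "(c' has_derivative E) (at s)"
    by (rule has_derivative_transform_within_open[OF _ I(1) s]) (simp add: c'1)
  then have c'': "vector_derivative c' (at s) = E 1"
    by (metis differentiableI frechet_derivative_at frechet_derivative_eq_vector_derivative scaleR_one)
  have cC: "c t \<bullet> a = d" "c t \<bullet> c t = 1" if "t \<in> I" for t
    using I(3)[OF that] C by (auto simp: norm_eq_1)
  have c'a: "c' t \<bullet> a = 0" "c' t \<bullet> c t = 0" if t: "t \<in> I" for t
    using inner_derivative_const[OF I(1) t cC(1) dc[OF t] has_derivative_const, of 1]
      inner_derivative_const[OF I(1) t cC(2) dc[OF t] dc[OF t], of 1] c'1[OF t]
    by (simp_all add: inner_commute)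
  have "E 1 \<bullet> a = 0" "E 1 \<bullet> c s + c' s \<bullet> c' s = 0"
    using inner_derivative_const[OF I(1) s c'a(1) dc' has_derivative_const, of 1]
      inner_derivative_const[OF I(1) s c'a(2) dc' dc[OF s], of 1] c'1[OF s]
    by simp_all
  then have "E 1 \<bullet> a = 0" "E 1 \<bullet> c s = - (c' s \<bullet> c' s)" by linarith+
  then have e: "E 1 \<bullet> (\<mu> *\<^sub>R (a - d *\<^sub>R c s)) = \<mu> * d * (norm (c' s))\<^sup>2"
    by (simp add: inner_diff_right power2_norm_eq_inner)
  have "c' s \<noteq> 0" using I(4)[OF s] by (simp add: c'_def)
  moreover have "geodesic_curvature c w s = E 1 \<bullet> w / (norm (c' s))\<^sup>2" for w
    using c'' by (simp add: geodesic_curvature_def c'_def[abs_def])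
  ultimately show ?thesis by (simp add: e del: inner_scaleR_right)
qed

definition circle_point :: "real^3 \<Rightarrow> real^3 \<Rightarrow> real \<Rightarrow> real \<Rightarrow> real^3" where
  "circle_point a e d s = d *\<^sub>R a + sqrt (1 - d\<^sup>2) *\<^sub>R (cos s *\<^sub>R e + sin s *\<^sub>R cross3 a e)"

locale sphere_circle_frame =
  fixes a e :: "real^3" and d :: real
  assumes a: "norm a = 1" and e: "norm e = 1" and ae: "a \<bullet> e = 0" and d: "\<bar>d\<bar> < 1"
begin

abbreviation \<gamma> where "\<gamma> \<equiv> circle_point a e d"
abbreviation r where "r \<equiv> sqrt (1 - d\<^sup>2)"
abbreviation f where "f \<equiv> cross3 a e"

lemma r: "0 < r" "r \<le> 1" "r\<^sup>2 = 1 - d\<^sup>2"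
proof -
  have "d\<^sup>2 < 1" using d by (simp add: abs_square_less_1)
  then show "0 < r" "r \<le> 1" "r\<^sup>2 = 1 - d\<^sup>2" by simp_all
qed

lemma frame: "a \<bullet> a = 1" "e \<bullet> e = 1" "f \<bullet> f = 1" "a \<bullet> e = 0" "e \<bullet> a = 0"
  "a \<bullet> f = 0" "f \<bullet> a = 0" "e \<bullet> f = 0" "f \<bullet> e = 0"
  using a e ae orthonormal_expansion(2)[OF a e ae] by (simp_all add: norm_eq_1 dot_cross_self inner_commute)

lemma circle_point_inner: "\<gamma> s \<bullet> a = d" "\<gamma> s \<bullet> e = r * cos s" "\<gamma> s \<bullet> f = r * sin s"
  by (simp_all add: circle_point_def inner_add_left frame)

text \<open>
  On the open half of the circle around \<open>\<gamma> 0\<close>, the component along the tangent \<open>f\<close> at \<open>\<gamma> 0\<close> is a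
  coordinate.
\<close>
lemma circle_eqI:
  assumes "norm p = 1" "norm q = 1" "p \<bullet> a = d" "q \<bullet> a = d" "p \<bullet> f = q \<bullet> f" "p \<bullet> e > 0" "q \<bullet> e > 0"
  shows "p = q"
proof -
  have "1 = d\<^sup>2 + (p \<bullet> e)\<^sup>2 + (q \<bullet> f)\<^sup>2" "1 = d\<^sup>2 + (q \<bullet> e)\<^sup>2 + (q \<bullet> f)\<^sup>2"
    using orthonormal_expansion(3)[OF a e ae, of p] orthonormal_expansion(3)[OF a e ae, of q] assms
    by (simp_all add: norm_eq_1)
  then have "(p \<bullet> e)\<^sup>2 = (q \<bullet> e)\<^sup>2" by linarith
  then have "p \<bullet> e = q \<bullet> e" using assms(6,7) by (simp add: power2_eq_iff_nonneg)
  then show ?thesis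
    using orthonormal_expansion(1)[OF a e ae, of p] orthonormal_expansion(1)[OF a e ae, of q] assms by metis
qed

lemma norm_circle_point: "norm (\<gamma> s) = 1"
proof -
  have "\<gamma> s \<bullet> \<gamma> s = d\<^sup>2 + r\<^sup>2 * ((cos s)\<^sup>2 + (sin s)\<^sup>2)"
    unfolding orthonormal_expansion(3)[OF a e ae, of "\<gamma> s"] circle_point_inner power_mult_distrib
    by (simp only: distrib_left add.assoc)
  then show ?thesis unfolding r(3) by (simp add: norm_eq_1)
qed

lemma circle_point_surj:
  assumes "norm p = 1" "p \<bullet> a = d"
  obtains s where "0 \<le> s" "p = \<gamma> s"
proof -
  have "(p \<bullet> e)\<^sup>2 + (p \<bullet> f)\<^sup>2 = r\<^sup>2"
    using orthonormal_expansion(3)[OF a e ae, of p] assms unfolding r(3) by (simp add: norm_eq_1)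
  then have "(p \<bullet> e / r)\<^sup>2 + (p \<bullet> f / r)\<^sup>2 = 1"
    using r(1) by (simp add: power_divide add_divide_distrib[symmetric] del: real_sqrt_pow2_iff)
  then obtain s where s: "0 \<le> s" "p \<bullet> e / r = cos s" "p \<bullet> f / r = sin s"
    using sincos_total_2pi by metis
  then have "p \<bullet> e = r * cos s" "p \<bullet> f = r * sin s" using r(1) by (simp_all add: field_simps)
  then have "p = \<gamma> s"
    using orthonormal_expansion(1)[OF a e ae, of p] assms(2)
    by (simp add: circle_point_def scaleR_add_right add.assoc)
  with s(1) show ?thesis using that by blast
qed

lemma range_circle_point: "range \<gamma> = {p \<in> sphere 0 1. p \<bullet> a = d}"
  using circle_point_surj norm_circle_point circle_point_inner(1) by (auto simp: image_iff) metis

definition velocity where "velocity s = r *\<^sub>R (cos s *\<^sub>R f - sin s *\<^sub>R e)"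

lemma circle_point_vector_derivative: "(\<gamma> has_vector_derivative velocity s) (at s)"
  unfolding circle_point_def[abs_def] velocity_def
  by (auto intro!: derivative_eq_intros simp: algebra_simps)

lemma velocity_vector_derivative:
  "(velocity has_vector_derivative (- r) *\<^sub>R (cos s *\<^sub>R e + sin s *\<^sub>R f)) (at s)"
  unfolding velocity_def[abs_def]
  by (auto intro!: derivative_eq_intros simp: algebra_simps)

lemma norm_velocity: "norm (velocity s) = r"
proof -
  let ?v = "cos s *\<^sub>R f - sin s *\<^sub>R e"
  have "?v \<bullet> ?v = (cos s)\<^sup>2 + (sin s)\<^sup>2"
    by (simp add: inner_diff_left inner_diff_right frame power2_eq_square)
  then have "norm ?v = 1" by (simp add: norm_eq_1)
  then show ?thesis using r(1) by (simp add: velocity_def)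
qed

lemma regular_circle_point: "regular_curve_in {p \<in> sphere 0 1. p \<bullet> a = d} \<gamma> UNIV"
proof -
  have d1: "frechet_derivative \<gamma> (at s) = (\<lambda>h. h *\<^sub>R velocity s)" for s
    using circle_point_vector_derivative[of s] frechet_derivative_at
    unfolding has_vector_derivative_def by metis
  have d2: "frechet_derivative velocity (at s) = (\<lambda>h. h *\<^sub>R (- r) *\<^sub>R (cos s *\<^sub>R e + sin s *\<^sub>R f))" for s
    using velocity_vector_derivative[of s] frechet_derivative_at
    unfolding has_vector_derivative_def by metis
  have "\<gamma> differentiable (at s)" "velocity differentiable (at s)" for s
    using circle_point_vector_derivative velocity_vector_derivative
    by (auto intro: differentiableI_vector)
  then have "Ck_on 2 \<gamma> UNIV"
    by (auto simp: numeral_2_eq_2 differentiable_on_eq_differentiable_at d1 d2 intro!: continuous_intros)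
  moreover have "vector_derivative \<gamma> (at s) = velocity s" for s
    using circle_point_vector_derivative vector_derivative_at by blast
  moreover have "velocity s \<noteq> 0" for s using norm_velocity[of s] r(1) by auto
  moreover have "range \<gamma> \<subseteq> {p \<in> sphere 0 1. p \<bullet> a = d}" using range_circle_point by simp
  ultimately show ?thesis unfolding regular_curve_in_def by simp
qed

text \<open>
  Rotating the frame about the axis shifts the parameter, so that local questions about the circle
  need only be treated at parameter \<open>0\<close>.
\<close>
lemma rotated_frame: "sphere_circle_frame a (cos t *\<^sub>R e + sin t *\<^sub>R f) d"
proof
  let ?b = "cos t *\<^sub>R e + sin t *\<^sub>R f"
  have "?b \<bullet> ?b = (cos t)\<^sup>2 + (sin t)\<^sup>2"
    by (simp add: inner_add_left inner_add_right frame power2_eq_square)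
  then show "norm ?b = 1" by (simp add: norm_eq_1)
  show "a \<bullet> ?b = 0" by (simp add: inner_add_right frame)
qed (use a d in auto)

lemma circle_point_rotated:
  "circle_point a (cos t *\<^sub>R e + sin t *\<^sub>R f) d s = \<gamma> (t + s)"
proof -
  have "cross3 a f = - e" using frame by (simp add: Lagrange)
  then have "cross3 a (cos t *\<^sub>R e + sin t *\<^sub>R f) = cos t *\<^sub>R f - sin t *\<^sub>R e"
    by (simp add: cross_add_right cross_mult_right)
  then show ?thesis
    unfolding circle_point_def cos_add sin_add by (simp only:) (simp add: algebra_simps)
qed

end


section \<open>Local lifts of the circle\<close>

context vertical_surface
begin

lemma continuous_F: "continuous_on S F"
  unfolding continuous_on_def
proof
  fix x assume "x \<in> S"
  then obtain U \<phi> u where lp: "local_param S F U \<phi>" "u \<in> U" "\<phi> u = x" by (rule chart)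
  note facts = chart_facts[OF lp(1)]
  obtain \<psi> where h: "homeomorphism U (\<phi> ` U) \<phi> \<psi>" and o: "openin (top_of_set S) (\<phi> ` U)"
    using lp unfolding local_param_def by blast
  have "continuous_on U (F \<circ> \<phi>)"
    using facts(7) has_derivative_continuous continuous_at_imp_continuous_on by blast
  then have "continuous_on (\<phi> ` U) (\<lambda>y. (F \<circ> \<phi>) (\<psi> y))"
    using h unfolding homeomorphism_def by (metis continuous_on_compose2 order.refl)
  then have "continuous_on (\<phi> ` U) F"
    by (rule continuous_on_eq) (use h in \<open>auto simp: homeomorphism_def\<close>)
  then have lim: "(F \<longlongrightarrow> F x) (at x within \<phi> ` U)"
    using lp by (auto simp: continuous_on_def)
  obtain T where T: "open T" "\<phi> ` U = S \<inter> T" using o unfolding openin_open by blast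
  have "at x within \<phi> ` U = at x within S"
    by (rule at_within_nhd[of x T]) (use T lp in auto)
  with lim show "(F \<longlongrightarrow> F x) (at x within S)" by simp
qed

text \<open>
  A map with injective derivative at \<open>u\<close> is injective near \<open>u\<close> if the derivative is continuous
  there in the operator norm. The operator norm of the difference of two derivatives is bounded by
  \<open>\<Delta>\<close>, the sum over the basis vectors, and the partial derivatives are continuous.
\<close>
lemma local_injectivity:
  fixes \<Psi> :: "(real^3) \<times> real \<Rightarrow> real \<times> real"
  assumes lp: "local_param S F U \<phi>" "u \<in> U" and L: "bounded_linear \<Psi>"
    and inj: "\<And>v. \<Psi> (frechet_derivative (F \<circ> \<phi>) (at u) v) = 0 \<Longrightarrow> v = 0"
  obtains r where "r > 0" "ball u r \<subseteq> U" "inj_on (\<lambda>x. \<Psi> (F (\<phi> x))) (ball u r)"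
proof -
  note facts = chart_facts[OF lp(1)]
  let ?D = "\<lambda>x v. \<Psi> (frechet_derivative (F \<circ> \<phi>) (at x) v)"
  have der: "((\<lambda>x. \<Psi> (F (\<phi> x))) has_derivative ?D x) (at x)" if "x \<in> U" for x
    using bounded_linear.has_derivative[OF L facts(7)[OF that]] by simp
  then have bl: "bounded_linear (?D x)" if "x \<in> U" for x
    using that has_derivative_bounded_linear by blast
  have "linear (?D u)" using bl[OF lp(2)] by (rule bounded_linear.linear)
  moreover from this have "inj (?D u)" using inj linear_injective_0 by blast
  ultimately obtain g where g: "linear g" "g \<circ> ?D u = id"
    using linear_injective_left_inverse by blast
  define \<Delta> where "\<Delta> x = (\<Sum>b\<in>Basis. norm (?D x b - ?D u b))" for x
  have "continuous_on U (\<lambda>x. frechet_derivative (F \<circ> \<phi>) (at x) b)" if "b \<in> Basis" for b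
    using Ck_on_2_derivatives(2)[OF facts(2,1) _ that that] has_derivative_continuous
      continuous_at_imp_continuous_on by blast
  then have "continuous_on U \<Delta>"
    unfolding \<Delta>_def by (intro continuous_intros bounded_linear.continuous_on[OF L]) auto
  moreover have "\<Delta> u = 0" by (simp add: \<Delta>_def)
  ultimately have small: "\<exists>\<delta>>0. \<forall>x\<in>U. dist x u < \<delta> \<longrightarrow> \<Delta> x < \<epsilon>" if "\<epsilon> > 0" for \<epsilon>
    using that lp(2) unfolding continuous_on_iff dist_real_def by (metis abs_less_iff diff_zero)
  obtain \<rho> where \<rho>: "\<rho> > 0" "ball u \<rho> \<subseteq> U" using facts(1) lp(2) openE by blast
  show ?thesis
  proof (rule has_derivative_locally_injective[of u U g ?D "\<lambda>x. \<Psi> (F (\<phi> x))"])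
    show "bounded_linear g" using g(1) linear_conv_bounded_linear by blast
    fix \<epsilon> :: real assume "\<epsilon> > 0"
    then obtain \<delta> where \<delta>: "\<delta> > 0" "\<And>x. x \<in> U \<Longrightarrow> dist x u < \<delta> \<Longrightarrow> \<Delta> x < \<epsilon>"
      using small by blast
    have "onorm (\<lambda>v. ?D x v - ?D u v) < \<epsilon>" if "dist u x < min \<rho> \<delta>" for x
    proof -
      have x: "x \<in> U" using that \<rho> by auto
      have "onorm (\<lambda>v. ?D x v - ?D u v) \<le> \<Delta> x"
        unfolding \<Delta>_def by (rule onorm_componentwise[OF bounded_linear_sub[OF bl[OF x] bl[OF lp(2)]]])
      then show ?thesis using \<delta>(2)[OF x] that by (simp add: dist_commute)
    qed
    then show "\<exists>d>0. \<forall>x. dist u x < d \<longrightarrow> onorm (\<lambda>v. ?D x v - ?D u v) < \<epsilon>"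
      using \<rho>(1) \<delta>(1) by (intro exI[of _ "min \<rho> \<delta>"]) auto
  qed (use lp facts(1) g der that in auto)
qed

text \<open>
  A surface over the circle is locally homeomorphic to the product of the circle and the line, so
  the circle lifts at constant height \<open>z\<close> through a given point. The coordinates
  \<open>\<Psi>\<close> on the product are the component along the tangent \<open>f\<close> at \<open>\<gamma> 0\<close> and the height.
  The neighbourhood \<open>W\<close> serves two purposes: uniqueness of lifts, and continuation of lifts that
  come near \<open>x\<close>.
\<close>
lemma local_lift_at_0:
  assumes fr: "sphere_circle_frame a e d" and on: "\<And>x. x \<in> S \<Longrightarrow> fst (F x) \<bullet> a = d"
    and x: "x \<in> S" and Fx: "F x = (circle_point a e d 0, z)"
  obtains \<delta> W \<eta> where "\<delta> > 0" "openin (top_of_set S) W" "x \<in> W" "continuous_on (ball 0 \<delta>) \<eta>"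
    and "\<And>s. s \<in> ball 0 \<delta> \<Longrightarrow> \<eta> s \<in> S \<and> F (\<eta> s) = (circle_point a e d s, z)"
    and "\<And>s y. s \<in> ball 0 \<delta> \<Longrightarrow> y \<in> W \<Longrightarrow> F y = (circle_point a e d s, z) \<Longrightarrow> y = \<eta> s"
proof -
  interpret sphere_circle_frame a e d by (rule fr)
  obtain U \<phi> u where lp: "local_param S F U \<phi>" "u \<in> U" "\<phi> u = x" using chart[OF x] .
  note facts = chart_facts[OF lp(1)]
  define \<Psi> :: "(real^3) \<times> real \<Rightarrow> real \<times> real" where "\<Psi> q = (fst q \<bullet> f, snd q)" for q
  have L: "bounded_linear \<Psi>"
    unfolding \<Psi>_def
    by (intro bounded_linear_Pair bounded_linear_snd
        bounded_linear_compose[OF bounded_linear_inner_left bounded_linear_fst])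
  have ker: "v = 0" if v: "\<Psi> (frechet_derivative (F \<circ> \<phi>) (at u) v) = 0" for v
  proof -
    let ?w = "frechet_derivative (F \<circ> \<phi>) (at u) v"
    have "fst ?w \<bullet> a + fst ((F \<circ> \<phi>) u) \<bullet> 0 = 0"
      by (rule inner_derivative_const[OF facts(1) lp(2) _ has_derivative_fst[OF facts(7)[OF lp(2)]]
            has_derivative_const, of a d])
         (use on facts(5) in auto)
    then have wa: "fst ?w \<bullet> a = 0" by simp
    have "fst ?w \<bullet> \<gamma> 0 = 0"
      using position_tangent_orthogonal[OF lp(1,2), of v] Fx lp(3) by simp
    then have we: "fst ?w \<bullet> e = 0" using wa r(1) by (simp add: circle_point_def inner_add_right)
    have "fst ?w \<bullet> f = 0" "snd ?w = 0" using v by (auto simp: \<Psi>_def prod_eq_iff)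
    then have "?w = 0" using wa we orthonormal_expansion(1)[OF a e ae, of "fst ?w"] by (simp add: prod_eq_iff)
    then show "v = 0" using facts(6)[OF lp(2)] linear_injective_0[OF facts(8)[OF lp(2)]] by blast
  qed
  obtain \<rho> where \<rho>: "\<rho> > 0" "ball u \<rho> \<subseteq> U" "inj_on (\<lambda>x. \<Psi> (F (\<phi> x))) (ball u \<rho>)"
    using local_injectivity[OF lp(1,2) L ker] .
  have cX: "continuous_on (ball u \<rho>) (\<lambda>x. F (\<phi> x))"
    using facts(4,5) \<rho>(2) by (intro continuous_on_compose2[OF continuous_F]) (auto intro: continuous_on_subset)
  \<comment> \<open>Only on the half of the circle with \<open>p \<bullet> e > 0\<close> do the coordinates \<open>\<Psi>\<close> determine the point.\<close>
  define V where "V = ball u \<rho> \<inter> (\<lambda>x. fst (F (\<phi> x)) \<bullet> e) -` {0<..}"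
  have V: "open V" "V \<subseteq> U" "V \<subseteq> ball u \<rho>"
    unfolding V_def using \<rho>(2)
    by (auto intro!: continuous_open_preimage continuous_intros cX)
  have uV: "u \<in> V" using \<rho>(1) lp(3) Fx r(1) by (simp add: V_def circle_point_inner)
  have c\<Psi>: "continuous_on V (\<lambda>x. \<Psi> (F (\<phi> x)))"
    using V(3) cX by (intro bounded_linear.continuous_on[OF L]) (auto intro: continuous_on_subset)
  have inj: "inj_on (\<lambda>x. \<Psi> (F (\<phi> x))) V" using \<rho>(3) V(3) inj_on_subset by blast
  have opV: "open ((\<lambda>x. \<Psi> (F (\<phi> x))) ` V)"
    by (rule invariance_of_domain_gen[OF V(1) c\<Psi> inj]) simp
  obtain g where g: "homeomorphism V ((\<lambda>x. \<Psi> (F (\<phi> x))) ` V) (\<lambda>x. \<Psi> (F (\<phi> x))) g"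
    by (rule invariance_of_domain_homeomorphism[OF V(1) c\<Psi> _ inj]) auto
  define k where "k s = (r * sin s, z)" for s
  have "open (k -` ((\<lambda>x. \<Psi> (F (\<phi> x))) ` V))"
    unfolding k_def by (intro open_vimage opV continuous_intros)
  moreover have "k 0 = \<Psi> (F (\<phi> u))"
    by (simp add: k_def \<Psi>_def lp(3) Fx circle_point_inner)
  ultimately obtain \<delta>0 where \<delta>0: "\<delta>0 > 0" "ball 0 \<delta>0 \<subseteq> k -` ((\<lambda>x. \<Psi> (F (\<phi> x))) ` V)"
    using uV openE[of "k -` ((\<lambda>x. \<Psi> (F (\<phi> x))) ` V)" 0] by blast
  \<comment> \<open>The bound \<open>pi / 2\<close> keeps \<open>\<gamma> s\<close> in the half of the circle with \<open>p \<bullet> e > 0\<close>.\<close>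
  define \<delta> where "\<delta> = min \<delta>0 (pi / 2)"
  have kV: "k s \<in> (\<lambda>x. \<Psi> (F (\<phi> x))) ` V" and cos: "cos s > 0" if "s \<in> ball 0 \<delta>" for s
    using that \<delta>0(2) by (auto simp: \<delta>_def intro!: cos_gt_zero_pi)
  define \<eta> where "\<eta> s = \<phi> (g (k s))" for s
  have gk: "g (k s) \<in> V" "\<Psi> (F (\<eta> s)) = k s" if "s \<in> ball 0 \<delta>" for s
    using g kV[OF that] unfolding homeomorphism_def \<eta>_def by auto
  show ?thesis
  proof (rule that)
    show "\<delta> > 0" using \<delta>0 by (simp add: \<delta>_def)
    show "openin (top_of_set S) (\<phi> ` V)" using local_param_openin_image[OF lp(1) V(1,2)] .
    show "x \<in> \<phi> ` V" using uV lp by blast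
    show "continuous_on (ball 0 \<delta>) \<eta>"
      unfolding \<eta>_def
    proof (rule continuous_on_compose2[OF facts(4)])
      show "continuous_on (ball 0 \<delta>) (\<lambda>s. g (k s))"
        using g kV unfolding homeomorphism_def k_def
        by (intro continuous_on_compose2[where f = "\<lambda>s. (r * sin s, z)" and g = g] continuous_intros) auto
      show "(\<lambda>s. g (k s)) ` ball 0 \<delta> \<subseteq> U" using gk(1) V(2) by blast
    qed
    show "\<eta> s \<in> S \<and> F (\<eta> s) = (\<gamma> s, z)" if s: "s \<in> ball 0 \<delta>" for s
    proof
      show S: "\<eta> s \<in> S" using gk(1)[OF s] V(2) facts(5) by (auto simp: \<eta>_def)
      have "fst (F (\<eta> s)) = \<gamma> s"
      proof (rule circle_eqI)
        show "norm (fst (F (\<eta> s))) = 1" "fst (F (\<eta> s)) \<bullet> a = d" using S position on by auto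
        show "fst (F (\<eta> s)) \<bullet> f = \<gamma> s \<bullet> f"
          using gk(2)[OF s] by (simp add: \<Psi>_def k_def circle_point_inner)
        show "fst (F (\<eta> s)) \<bullet> e > 0" using gk(1)[OF s] by (simp add: V_def \<eta>_def)
        show "\<gamma> s \<bullet> e > 0" using cos[OF s] r(1) by (simp add: circle_point_inner)
      qed (simp_all add: norm_circle_point circle_point_inner)
      moreover have "snd (F (\<eta> s)) = z" using gk(2)[OF s] by (simp add: \<Psi>_def k_def)
      ultimately show "F (\<eta> s) = (\<gamma> s, z)" by (simp add: prod_eq_iff)
    qed
    show "y = \<eta> s" if s: "s \<in> ball 0 \<delta>" and y: "y \<in> \<phi> ` V" "F y = (\<gamma> s, z)" for s y
    proof -
      obtain v where v: "v \<in> V" "y = \<phi> v" using y by blast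
      have "\<Psi> (F (\<phi> v)) = k s" using y v by (simp add: \<Psi>_def k_def circle_point_inner)
      then have "g (k s) = v" using g v(1) unfolding homeomorphism_def by metis
      then show ?thesis using v by (simp add: \<eta>_def)
    qed
  qed
qed

lemma local_lift:
  assumes fr: "sphere_circle_frame a e d" and on: "\<And>x. x \<in> S \<Longrightarrow> fst (F x) \<bullet> a = d"
    and x: "x \<in> S" and Fx: "F x = (circle_point a e d t, z)"
  obtains \<delta> W \<eta> where "\<delta> > 0" "openin (top_of_set S) W" "x \<in> W" "continuous_on (ball t \<delta>) \<eta>"
    and "\<And>s. s \<in> ball t \<delta> \<Longrightarrow> \<eta> s \<in> S \<and> F (\<eta> s) = (circle_point a e d s, z)"
    and "\<And>s y. s \<in> ball t \<delta> \<Longrightarrow> y \<in> W \<Longrightarrow> F y = (circle_point a e d s, z) \<Longrightarrow> y = \<eta> s"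
proof -
  interpret sphere_circle_frame a e d by (rule fr)
  have rot: "circle_point a (cos t *\<^sub>R e + sin t *\<^sub>R f) d (s - t) = \<gamma> s" for s
    by (simp add: circle_point_rotated)
  have F0: "F x = (circle_point a (cos t *\<^sub>R e + sin t *\<^sub>R f) d 0, z)" using Fx rot[of t] by simp
  show ?thesis
  proof (rule local_lift_at_0[OF rotated_frame[of t] on x F0])
    fix \<delta> W \<eta>
    assume *: "\<delta> > 0" "openin (top_of_set S) W" "x \<in> W" "continuous_on (ball 0 \<delta>) \<eta>"
      "\<And>s. s \<in> ball 0 \<delta> \<Longrightarrow> \<eta> s \<in> S \<and> F (\<eta> s) = (circle_point a (cos t *\<^sub>R e + sin t *\<^sub>R f) d s, z)"
      "\<And>s y. s \<in> ball 0 \<delta> \<Longrightarrow> y \<in> W \<Longrightarrow> F y = (circle_point a (cos t *\<^sub>R e + sin t *\<^sub>R f) d s, z) \<Longrightarrow> y = \<eta> s"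
    have b: "s - t \<in> ball 0 \<delta>" if "s \<in> ball t \<delta>" for s
      using that by (simp add: dist_real_def)
    show ?thesis
    proof (rule that[OF *(1-3)])
      show "continuous_on (ball t \<delta>) (\<lambda>s. \<eta> (s - t))"
        using b by (intro continuous_on_compose2[OF *(4)] continuous_intros) auto
      show "\<eta> (s - t) \<in> S \<and> F (\<eta> (s - t)) = (\<gamma> s, z)" if "s \<in> ball t \<delta>" for s
        using *(5)[OF b[OF that]] by (simp add: rot)
      show "y = \<eta> (s - t)" if "s \<in> ball t \<delta>" "y \<in> W" "F y = (\<gamma> s, z)" for s y
        using *(6)[OF b[OF that(1)] that(2)] that(3) by (simp add: rot)
    qed
  qed
qed

end


section \<open>Global lifts and completeness\<close>

locale circular_surface = vertical_surface S F N + sphere_circle_frame a e d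
  for S :: "'a::t2_space set" and F N a e d +
  assumes on_circle: "x \<in> S \<Longrightarrow> fst (F x) \<bullet> a = d"
begin

definition horizontal_lift :: "real \<Rightarrow> real \<Rightarrow> (real \<Rightarrow> 'a) \<Rightarrow> bool" where
  "horizontal_lift z b \<beta> \<longleftrightarrow>
     continuous_on {0..b} \<beta> \<and> (\<forall>s\<in>{0..b}. \<beta> s \<in> S \<and> F (\<beta> s) = (\<gamma> s, z))"

text \<open>
  Whether the two lifts agree is a locally constant property of the parameter: where they agree,
  both are given by the same local lift; where they differ, disjoint neighbourhoods keep them apart.
\<close>
lemma horizontal_lift_unique:
  assumes \<beta>: "horizontal_lift z b \<beta>\<^sub>1" "horizontal_lift z b \<beta>\<^sub>2" and 0: "\<beta>\<^sub>1 0 = \<beta>\<^sub>2 0" and s: "s \<in> {0..b}"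
  shows "\<beta>\<^sub>1 s = \<beta>\<^sub>2 s"
proof -
  have "\<forall>t\<in>{0..b}. eventually (\<lambda>s. (\<beta>\<^sub>1 t = \<beta>\<^sub>2 t) = (\<beta>\<^sub>1 s = \<beta>\<^sub>2 s)) (at t within {0..b})"
  proof
    fix t assume t: "t \<in> {0..b}"
    have lim: "(\<beta>\<^sub>1 \<longlongrightarrow> \<beta>\<^sub>1 t) (at t within {0..b})" "(\<beta>\<^sub>2 \<longlongrightarrow> \<beta>\<^sub>2 t) (at t within {0..b})"
      using \<beta> t by (auto simp: horizontal_lift_def continuous_on_def)
    show "eventually (\<lambda>s. (\<beta>\<^sub>1 t = \<beta>\<^sub>2 t) = (\<beta>\<^sub>1 s = \<beta>\<^sub>2 s)) (at t within {0..b})"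
    proof (cases "\<beta>\<^sub>1 t = \<beta>\<^sub>2 t")
      case False
      then obtain A B where "open A" "open B" "\<beta>\<^sub>1 t \<in> A" "\<beta>\<^sub>2 t \<in> B" "A \<inter> B = {}"
        using hausdorff by meson
      then have "eventually (\<lambda>s. \<beta>\<^sub>1 s \<in> A \<and> \<beta>\<^sub>2 s \<in> B) (at t within {0..b})"
        using lim by (auto simp: tendsto_def eventually_conj)
      then show ?thesis
        by eventually_elim (use False \<open>A \<inter> B = {}\<close> in auto)
    next
      case True
      have x: "\<beta>\<^sub>1 t \<in> S" "F (\<beta>\<^sub>1 t) = (\<gamma> t, z)" using \<beta> t by (auto simp: horizontal_lift_def)
      show ?thesis
      proof (rule local_lift[OF sphere_circle_frame_axioms on_circle x])
        fix \<delta> W \<eta>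
        assume \<delta>: "\<delta> > 0" and W: "openin (top_of_set S) W" "\<beta>\<^sub>1 t \<in> W"
          and \<eta>: "\<And>s y. s \<in> ball t \<delta> \<Longrightarrow> y \<in> W \<Longrightarrow> F y = (\<gamma> s, z) \<Longrightarrow> y = \<eta> s"
        obtain T where T: "open T" "W = S \<inter> T" using W(1) unfolding openin_open by blast
        have "eventually (\<lambda>s. \<beta>\<^sub>1 s \<in> T) (at t within {0..b})"
          using lim(1) T W(2) by (auto simp: tendsto_def)
        moreover have "eventually (\<lambda>s. \<beta>\<^sub>2 s \<in> T) (at t within {0..b})"
          using lim(2) T W(2) True by (auto simp: tendsto_def)
        moreover have "eventually (\<lambda>s. s \<in> ball t \<delta>) (at t within {0..b})"
          using \<delta> by (intro eventually_at_in_open' [THEN filter_leD[OF at_le[OF subset_UNIV]]]) auto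
        moreover have "eventually (\<lambda>s. s \<in> {0..b}) (at t within {0..b})"
          by (auto simp: eventually_at_filter)
        ultimately show ?thesis
        proof eventually_elim
          case (elim s)
          then have "\<beta>\<^sub>1 s \<in> W" "F (\<beta>\<^sub>1 s) = (\<gamma> s, z)" "\<beta>\<^sub>2 s \<in> W" "F (\<beta>\<^sub>2 s) = (\<gamma> s, z)"
            using \<beta> T(2) by (auto simp: horizontal_lift_def)
          then have "\<beta>\<^sub>1 s = \<eta> s" "\<beta>\<^sub>2 s = \<eta> s" using \<eta>[OF elim(3)] by blast+
          then show ?case using True by simp
        qed
      qed
    qed
  qed
  moreover have "0 \<in> {0..b}" using s by auto
  ultimately have "(\<beta>\<^sub>1 0 = \<beta>\<^sub>2 0) = (\<beta>\<^sub>1 s = \<beta>\<^sub>2 s)"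
    using connected_local_const[of "{0..b}" 0 s "\<lambda>s. \<beta>\<^sub>1 s = \<beta>\<^sub>2 s"] s by simp
  with 0 show ?thesis by simp
qed

text \<open>
  The velocity of a lift has norm \<open>r \<le> 1\<close>. The joining path must have two-sided derivatives at its
  end points, although the lift may not extend beyond \<open>{0..b}\<close>; the reparametrization \<open>\<sigma>\<close> by a
  cosine oscillates between \<open>s\<close> and \<open>t\<close> and makes the path smooth on the whole line. Its
  speed exceeds that of the affine parametrization by the factor \<open>pi / 2 < 2\<close> at most.
\<close>
lemma horizontal_lift_short:
  assumes \<beta>: "horizontal_lift z b \<beta>" and s: "s \<in> {0..b}" and t: "t \<in> {0..b}" and less: "2 * \<bar>t - s\<bar> < \<epsilon>"
  shows "joined_by_length_less S F (\<beta> s) (\<beta> t) \<epsilon>"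
proof -
  define \<sigma> where "\<sigma> \<tau> = s + (t - s) * ((1 - cos (pi * \<tau>)) / 2)" for \<tau>
  define \<sigma>' where "\<sigma>' \<tau> = (t - s) * (pi / 2 * sin (pi * \<tau>))" for \<tau>
  have \<sigma>: "\<sigma> \<tau> \<in> {0..b}" for \<tau>
  proof -
    define k where "k = (1 - cos (pi * \<tau>)) / 2"
    have k: "0 \<le> k" "k \<le> 1"
      using cos_ge_minus_one[of "pi * \<tau>"] cos_le_one[of "pi * \<tau>"] by (auto simp: k_def)
    have "\<sigma> \<tau> = s + (t - s) * k" by (simp add: \<sigma>_def k_def)
    then have "\<sigma> \<tau> = (1 - k) *\<^sub>R s + k *\<^sub>R t" by (simp add: algebra_simps)
    then show ?thesis
      using convexD[OF convex_real_interval(5)[of 0 b] s t, of "1 - k" k] k by simp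
  qed
  have d\<sigma>: "(\<sigma> has_vector_derivative \<sigma>' \<tau>) (at \<tau>)" for \<tau>
    unfolding \<sigma>_def[abs_def] \<sigma>'_def has_real_derivative_iff_has_vector_derivative[symmetric]
    by (auto intro!: derivative_eq_intros)
  have F\<alpha>: "F \<circ> (\<beta> \<circ> \<sigma>) = (\<lambda>\<tau>. (\<gamma> (\<sigma> \<tau>), z))"
    using \<beta> \<sigma> by (auto simp: horizontal_lift_def fun_eq_iff)
  have d\<alpha>: "(F \<circ> (\<beta> \<circ> \<sigma>) has_vector_derivative (\<sigma>' \<tau> *\<^sub>R velocity (\<sigma> \<tau>), 0)) (at \<tau>)" for \<tau>
    unfolding F\<alpha>
    using vector_diff_chain_at[OF d\<sigma> circle_point_vector_derivative]
    by (intro has_vector_derivative_Pair) (auto simp: o_def)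
  have c\<sigma>: "continuous_on UNIV \<sigma>" unfolding \<sigma>_def[abs_def] by (intro continuous_intros) auto
  have c\<alpha>': "continuous_on UNIV (\<lambda>\<tau>. (\<sigma>' \<tau> *\<^sub>R velocity (\<sigma> \<tau>), 0::real))"
    unfolding \<sigma>'_def velocity_def using c\<sigma> by (intro continuous_intros) auto
  have bound: "norm (\<sigma>' \<tau> *\<^sub>R velocity (\<sigma> \<tau>), 0::real) \<le> 2 * \<bar>t - s\<bar>" for \<tau>
  proof -
    have "\<bar>\<sigma>' \<tau>\<bar> = \<bar>t - s\<bar> * (pi / 2 * \<bar>sin (pi * \<tau>)\<bar>)" by (simp add: \<sigma>'_def abs_mult)
    also have "\<dots> \<le> \<bar>t - s\<bar> * (2 * 1)"
      using pi_less_4 by (intro mult_left_mono mult_mono) auto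
    finally have "\<bar>\<sigma>' \<tau>\<bar> * r \<le> (2 * \<bar>t - s\<bar>) * 1" using r by (intro mult_mono) auto
    moreover have "norm (v, 0::real) = norm v" for v :: "real^3" by (simp add: norm_prod_def)
    ultimately show ?thesis by (simp only: norm_scaleR norm_velocity mult_1_right)
  qed
  have "norm (integral {0..1} (\<lambda>\<tau>. norm (\<sigma>' \<tau> *\<^sub>R velocity (\<sigma> \<tau>), 0::real))) \<le> (2 * \<bar>t - s\<bar>) * (1 - 0)"
  proof (rule integral_bound)
    show "continuous_on {0..1} (\<lambda>\<tau>. norm (\<sigma>' \<tau> *\<^sub>R velocity (\<sigma> \<tau>), 0::real))"
      using continuous_on_subset[OF c\<alpha>'] by (intro continuous_on_norm) auto
    show "norm (norm (\<sigma>' \<tau> *\<^sub>R velocity (\<sigma> \<tau>), 0::real)) \<le> 2 * \<bar>t - s\<bar>" for \<tau>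
      using bound by simp
  qed simp
  moreover have "vector_derivative (F \<circ> (\<beta> \<circ> \<sigma>)) (at \<tau>) = (\<sigma>' \<tau> *\<^sub>R velocity (\<sigma> \<tau>), 0)" for \<tau>
    using d\<alpha> vector_derivative_at by blast
  ultimately have "integral {0..1} (\<lambda>\<tau>. norm (vector_derivative (F \<circ> (\<beta> \<circ> \<sigma>)) (at \<tau>))) < \<epsilon>"
    using less by simp
  moreover have "path (\<beta> \<circ> \<sigma>)"
    unfolding path_def using \<beta> \<sigma>
    by (intro continuous_on_compose continuous_on_subset[OF c\<sigma>])
       (auto simp: horizontal_lift_def intro: continuous_on_subset)
  moreover have "path_image (\<beta> \<circ> \<sigma>) \<subseteq> S"
    using \<beta> \<sigma> by (auto simp: path_image_def horizontal_lift_def)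
  moreover have "pathstart (\<beta> \<circ> \<sigma>) = \<beta> s" "pathfinish (\<beta> \<circ> \<sigma>) = \<beta> t"
    by (simp_all add: pathstart_def pathfinish_def \<sigma>_def)
  moreover have "(F \<circ> (\<beta> \<circ> \<sigma>)) C1_differentiable_on {0..1}"
    unfolding C1_differentiable_on_def
    by (intro exI[of _ "\<lambda>\<tau>. (\<sigma>' \<tau> *\<^sub>R velocity (\<sigma> \<tau>), 0)"] conjI ballI d\<alpha>
        continuous_on_subset[OF c\<alpha>'] subset_UNIV)
  ultimately show ?thesis unfolding joined_by_length_less_def by (intro exI[of _ "\<beta> \<circ> \<sigma>"] conjI)
qed

lemma horizontal_lift_extend:
  assumes \<beta>: "horizontal_lift z b \<beta>" and b: "0 \<le> b" "b \<le> c"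
    and \<eta>: "continuous_on {b..c} \<eta>" "\<And>s. s \<in> {b..c} \<Longrightarrow> \<eta> s \<in> S \<and> F (\<eta> s) = (\<gamma> s, z)" "\<beta> b = \<eta> b"
  shows "horizontal_lift z c (\<lambda>s. if s \<le> b then \<beta> s else \<eta> s)"
proof -
  have "continuous_on ({0..b} \<union> {b..c}) (\<lambda>s. if s \<le> b then \<beta> s else \<eta> s)"
    by (rule continuous_on_cases) (use \<beta> \<eta> in \<open>auto simp: horizontal_lift_def\<close>)
  moreover have "{0..b} \<union> {b..c} = {0..c}" using b by auto
  ultimately show ?thesis using \<beta> \<eta>(2) b by (auto simp: horizontal_lift_def)
qed

text \<open>
  If the lifts from \<open>x0\<close> stopped at a finite parameter \<open>m\<close>, their end points at parameters
  \<open>t n\<close> tending to \<open>m\<close> would be Cauchy for the intrinsic distance. By completeness they converge to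
  a point over \<open>\<gamma> m\<close>, and the local lift there continues a lift beyond \<open>m\<close>.
\<close>
lemma horizontal_lift_exists:
  assumes complete: "complete_surface S F" and x0: "x0 \<in> S" "F x0 = (\<gamma> 0, z)" and b: "0 \<le> b"
  obtains \<beta> where "horizontal_lift z b \<beta>" "\<beta> 0 = x0"
proof (rule ccontr)
  assume none: "\<not> thesis"
  define B where "B = {b. 0 \<le> b \<and> (\<exists>\<beta>. horizontal_lift z b \<beta> \<and> \<beta> 0 = x0)}"
  have restrict: "horizontal_lift z s \<beta>" if "horizontal_lift z t \<beta>" "s \<le> t" for s t \<beta>
    using that by (auto simp: horizontal_lift_def intro: continuous_on_subset)
  have down: "s \<in> B" if "t \<in> B" "0 \<le> s" "s \<le> t" for s t
    using that restrict unfolding B_def by blast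
  have "b \<notin> B" using none that by (auto simp: B_def)
  then have up: "s \<le> b" if "s \<in> B" for s using down that b by (meson linear)
  have "horizontal_lift z 0 (\<lambda>_. x0)" using x0 by (simp add: horizontal_lift_def)
  then have B0: "0 \<in> B" by (auto simp: B_def)
  have bdd: "bdd_above B" using up by (meson bdd_aboveI)
  define m where "m = Sup B"
  have m0: "0 \<le> m" unfolding m_def using B0 bdd by (rule cSup_upper)
  \<comment> \<open>All \<open>t n\<close> are below \<open>m\<close>, or equal to it if \<open>m = 0\<close>; so they belong to \<open>B\<close> even if the
    supremum is not attained.\<close>
  define t where "t n = m * (1 - 1 / real (Suc n))" for n
  have tm: "t \<longlonglongrightarrow> m"
  proof -
    have "(\<lambda>n. m * (1 - 1 / real (Suc n))) \<longlonglongrightarrow> m * (1 - 0)"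
      by (intro tendsto_intros LIMSEQ_Suc[OF lim_1_over_n])
    then show ?thesis by (simp add: t_def[abs_def])
  qed
  have t0: "0 \<le> t n" for n
    using m0 by (simp add: t_def)
  have tlem: "t n \<le> m" for n
    using mult_left_mono[OF _ m0, of "1 - 1 / real (Suc n)" 1] by (simp add: t_def)
  have tB: "t n \<in> B" for n
  proof (cases "m = 0")
    case True then show ?thesis using B0 by (simp add: t_def)
  next
    case False
    then have "t n < Sup B" using m0 by (simp add: t_def m_def mult_less_cancel_left1)
    then obtain s where "s \<in> B" "t n < s" using less_cSupD[of B "t n"] B0 by blast
    then show ?thesis using down t0 by (meson less_imp_le)
  qed
  then have "\<exists>\<beta>. \<forall>n. horizontal_lift z (t n) (\<beta> n) \<and> \<beta> n 0 = x0"
    unfolding B_def by (intro choice) blast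
  then obtain \<beta> where \<beta>: "\<And>n. horizontal_lift z (t n) (\<beta> n)" "\<And>n. \<beta> n 0 = x0" by blast
  define \<sigma> where "\<sigma> n = \<beta> n (t n)" for n
  have \<sigma>S: "\<sigma> n \<in> S" "F (\<sigma> n) = (\<gamma> (t n), z)" for n
    using \<beta>(1)[of n] t0[of n] by (auto simp: \<sigma>_def horizontal_lift_def)
  have agree: "\<beta> k (t n) = \<sigma> n" if "t n \<le> t k" for n k
    unfolding \<sigma>_def
  proof (rule horizontal_lift_unique)
    show "horizontal_lift z (t n) (\<beta> k)"
      using restrict[OF \<beta>(1)[of k] that] .
  qed (use \<beta> t0 in auto)
  have "\<exists>K. \<forall>i\<ge>K. \<forall>j\<ge>K. joined_by_length_less S F (\<sigma> i) (\<sigma> j) \<epsilon>" if "\<epsilon> > 0" for \<epsilon>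
  proof -
    have "\<epsilon> / 2 > 0" using that by simp
    then obtain K where K: "\<forall>i\<ge>K. \<forall>j\<ge>K. norm (t i - t j) < \<epsilon> / 2"
      using CauchyD[OF LIMSEQ_imp_Cauchy[OF tm]] by blast
    have "joined_by_length_less S F (\<sigma> i) (\<sigma> j) \<epsilon>" if ij: "i \<ge> K" "j \<ge> K" for i j
    proof -
      obtain k where "t i \<le> t k" "t j \<le> t k" by (meson linear)
      then show ?thesis
        using horizontal_lift_short[OF \<beta>(1)[of k], of "t i" "t j" \<epsilon>] agree t0
          K[rule_format, OF ij(2,1)] by simp
    qed
    then show ?thesis by blast
  qed
  then obtain x where x: "x \<in> S" "\<sigma> \<longlonglongrightarrow> x"
    using complete \<sigma>S(1) unfolding complete_surface_def by blast
  have "(\<lambda>n. F (\<sigma> n)) \<longlonglongrightarrow> F x"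
    by (rule continuous_on_tendsto_compose[OF continuous_F x(2,1)]) (simp add: \<sigma>S)
  moreover have "(\<lambda>n. F (\<sigma> n)) \<longlonglongrightarrow> (\<gamma> m, z)"
    unfolding \<sigma>S(2) using circle_point_vector_derivative[of m] has_vector_derivative_continuous
    by (intro tendsto_Pair tendsto_const isCont_tendsto_compose[OF _ tm]) blast
  ultimately have Fx: "F x = (\<gamma> m, z)" by (rule LIMSEQ_unique)
  show False
  proof (rule local_lift[OF sphere_circle_frame_axioms on_circle x(1) Fx])
    fix \<delta> W \<eta>
    assume \<delta>: "\<delta> > 0" and W: "openin (top_of_set S) W" "x \<in> W" and c\<eta>: "continuous_on (ball m \<delta>) \<eta>"
      and \<eta>: "\<And>s. s \<in> ball m \<delta> \<Longrightarrow> \<eta> s \<in> S \<and> F (\<eta> s) = (\<gamma> s, z)"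
        "\<And>s y. s \<in> ball m \<delta> \<Longrightarrow> y \<in> W \<Longrightarrow> F y = (\<gamma> s, z) \<Longrightarrow> y = \<eta> s"
    obtain T where T: "open T" "W = S \<inter> T" using W(1) unfolding openin_open by blast
    have "eventually (\<lambda>n. \<sigma> n \<in> T) sequentially"
      using topological_tendstoD[OF x(2) T(1)] T(2) W(2) by blast
    moreover have "eventually (\<lambda>n. t n \<in> ball m \<delta>) sequentially"
      using topological_tendstoD[OF tm open_ball] \<delta> by simp
    ultimately have "eventually (\<lambda>n. \<sigma> n \<in> T \<and> t n \<in> ball m \<delta>) sequentially"
      by (rule eventually_conj)
    then obtain n where n: "\<sigma> n \<in> T" "t n \<in> ball m \<delta>"
      using eventually_happens' sequentially_bot by blast
    define c where "c = m + \<delta> / 2"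
    have sub: "{t n..c} \<subseteq> ball m \<delta>"
      using n(2) \<delta> by (auto simp: c_def dist_real_def)
    have "\<beta> n (t n) = \<eta> (t n)"
      using \<eta>(2)[OF n(2), of "\<sigma> n"] n(1) \<sigma>S[of n] T(2) by (simp add: \<sigma>_def)
    then have "horizontal_lift z c (\<lambda>s. if s \<le> t n then \<beta> n s else \<eta> s)"
      using sub \<eta>(1) tlem[of n] \<delta> t0[of n]
      by (intro horizontal_lift_extend[OF \<beta>(1)] continuous_on_subset[OF c\<eta>]) (auto simp: c_def)
    then have "c \<in> B" using \<beta>(2)[of n] t0[of n] m0 \<delta> by (auto simp: B_def c_def)
    then have "c \<le> m" unfolding m_def using bdd by (rule cSup_upper)
    then show False using \<delta> by (simp add: c_def)
  qed
qed

end


section \<open>The generating curve of a translator\<close>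

context vertical_surface
begin

lemma generating_curve_eq: "generating_curve S F = (\<lambda>x. fst (F x)) ` S"
proof -
  have "(\<lambda>x. fst (F x)) ` S = fst ` (generating_curve S F \<times> (UNIV :: real set))"
    unfolding vertically_invariant_eq_cylinder[OF invariant, symmetric] by (simp add: image_image)
  then show ?thesis by simp
qed

lemma frame_through_point:
  assumes a: "norm a = 1" "\<bar>d\<bar> < 1" and on: "\<And>x. x \<in> S \<Longrightarrow> fst (F x) \<bullet> a = d" and x: "x \<in> S"
  obtains e where "sphere_circle_frame a e d" "fst (F x) = circle_point a e d 0"
proof -
  define q where "q = fst (F x)"
  define r where "r = sqrt (1 - d\<^sup>2)"
  have "d\<^sup>2 < 1" using a(2) by (simp add: abs_square_less_1)
  then have r: "r > 0" "r\<^sup>2 = 1 - d\<^sup>2" by (simp_all add: r_def)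
  define e where "e = (1 / r) *\<^sub>R (q - d *\<^sub>R a)"
  have q: "q \<bullet> q = 1" "q \<bullet> a = d" "a \<bullet> a = 1" "a \<bullet> q = d"
    using position[OF x] on[OF x] a(1) by (auto simp: q_def norm_eq_1 inner_commute)
  have "(q - d *\<^sub>R a) \<bullet> (q - d *\<^sub>R a) = r\<^sup>2"
    unfolding r(2) by (simp add: inner_diff_left inner_diff_right q power2_eq_square)
  then have "e \<bullet> e = 1" using r(1) by (simp add: e_def power2_eq_square)
  moreover have "a \<bullet> e = 0" by (simp add: e_def inner_diff_right q)
  ultimately have "sphere_circle_frame a e d"
    using a by unfold_locales (simp_all add: norm_eq_1)
  moreover have "q = circle_point a e d 0"
    using r(1) by (simp add: circle_point_def e_def r_def[symmetric])
  ultimately show ?thesis using that unfolding q_def by blast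
qed

text \<open>
  Every point of the circle is \<open>\<gamma> s\<close> with \<open>s \<ge> 0\<close>, hence the projection of the end point of a lift.
  This is where completeness excludes proper arcs of the circle.
\<close>
lemma generating_curve_closes:
  assumes complete: "complete_surface S F"
    and a: "norm a = 1" "\<bar>d\<bar> < 1" and on: "\<And>x. x \<in> S \<Longrightarrow> fst (F x) \<bullet> a = d"
  shows "generating_curve S F = {p \<in> sphere 0 1. p \<bullet> a = d}"
proof -
  obtain x0 where x0: "x0 \<in> S" using immersed unfolding immersed_surface_def by blast
  obtain e where fr: "sphere_circle_frame a e d" and q: "fst (F x0) = circle_point a e d 0"
    by (rule frame_through_point[OF a on x0])
  interpret circular_surface S F N a e d
    using fr on by (intro circular_surface.intro vertical_surface_axioms) (simp_all add: circular_surface_axioms_def)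
  have Fx0: "F x0 = (\<gamma> 0, snd (F x0))" using q by (simp add: prod_eq_iff)
  have "p \<in> generating_curve S F" if p: "norm p = 1" "p \<bullet> a = d" for p
  proof -
    obtain s where s: "0 \<le> s" "p = \<gamma> s" using circle_point_surj[OF p] .
    obtain \<beta> where "horizontal_lift (snd (F x0)) s \<beta>" "\<beta> 0 = x0"
      using horizontal_lift_exists[OF complete x0 Fx0 s(1)] .
    then have "\<beta> s \<in> S" "fst (F (\<beta> s)) = p" using s by (auto simp: horizontal_lift_def)
    then show ?thesis unfolding generating_curve_eq by blast
  qed
  then show "generating_curve S F = {p \<in> sphere 0 1. p \<bullet> a = d}"
    using on position by (auto simp: generating_curve_eq)
qed

end

theorem proposition2p6:
  fixes S :: "'a::t2_space set"
    and F N :: "'a \<Rightarrow> (real^3) \<times> real"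
    and \<Lambda> :: real
  assumes "\<Lambda> \<noteq> 0"
    and "immersed_surface S F"
    and "connected S"
    and "complete_surface S F"
    and "unit_normal S F N"
    and "vertically_invariant S F"
  shows "translator S F N \<Lambda> \<longleftrightarrow>
    sphere_circle (generating_curve S F) \<and>
    generating_curve_has_curvature S F N (2 * \<Lambda>)"
proof
  interpret vertical_surface S F N
    using assms by unfold_locales
  let ?C = "generating_curve S F"
  {
    assume "translator S F N \<Lambda>"
    then obtain a d \<mu> where ad: "norm a = 1" "\<bar>d\<bar> < 1" and \<mu>: "\<mu> * d = 2 * \<Lambda>"
      and on: "\<And>x. x \<in> S \<Longrightarrow> fst (F x) \<bullet> a = d"
      and N: "\<And>x. x \<in> S \<Longrightarrow> fst (N x) = \<mu> *\<^sub>R (a - d *\<^sub>R fst (F x))"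
      using translator_in_circle[OF _ \<open>connected S\<close>] by metis
    have circle: "?C = {p \<in> sphere 0 1. p \<bullet> a = d}"
      by (rule generating_curve_closes[OF \<open>complete_surface S F\<close> ad]) (rule on)
    obtain x0 where x0: "x0 \<in> S" using immersed unfolding immersed_surface_def by blast
    obtain e where "sphere_circle_frame a e d"
      by (rule frame_through_point[OF ad on x0])
    then interpret sphere_circle_frame a e d .
    have "has_geodesic_curvature ?C (fst (F x)) (fst (N x)) (2 * \<Lambda>)" if x: "x \<in> S" for x
      unfolding has_geodesic_curvature_def
    proof
      obtain s where "fst (F x) = \<gamma> s" using circle_point_surj[OF position[OF x] on[OF x]] by metis
      moreover have "regular_curve_in ?C \<gamma> UNIV" using regular_circle_point circle by simp
      ultimately show "\<exists>c I s. regular_curve_in ?C c I \<and> s \<in> I \<and> c s = fst (F x)" by force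
      show "\<forall>c I s. regular_curve_in ?C c I \<and> s \<in> I \<and> c s = fst (F x) \<longrightarrow>
          geodesic_curvature c (fst (N x)) s = 2 * \<Lambda>"
      proof (intro allI impI, elim conjE)
        fix c I s assume c: "regular_curve_in ?C c I" "s \<in> I" "c s = fst (F x)"
        show "geodesic_curvature c (fst (N x)) s = 2 * \<Lambda>"
          using geodesic_curvature_in_circle[OF c(1) equalityD1[OF circle] c(2), of \<mu>]
          by (simp add: N[OF x] \<mu> c(3))
      qed
    qed
    moreover have "sphere_circle ?C" using ad circle unfolding sphere_circle_def by blast
    ultimately show "sphere_circle ?C \<and> generating_curve_has_curvature S F N (2 * \<Lambda>)"
      unfolding generating_curve_has_curvature_def by blast
  next
    assume "sphere_circle ?C \<and> generating_curve_has_curvature S F N (2 * \<Lambda>)"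
    then obtain a d where a: "norm a = 1" "\<bar>d\<bar> < 1" and C: "?C = {p \<in> sphere 0 1. p \<bullet> a = d}"
      and curv: "\<And>x. x \<in> S \<Longrightarrow> has_geodesic_curvature ?C (fst (F x)) (fst (N x)) (2 * \<Lambda>)"
      unfolding sphere_circle_def generating_curve_has_curvature_def by blast
    have on: "fst (F x) \<bullet> a = d" if "x \<in> S" for x
      using C that unfolding generating_curve_eq by blast
    show "translator S F N \<Lambda>"
      unfolding translator_def
    proof (intro allI impI ballI)
      fix U \<phi> u assume lp: "local_param S F U \<phi>" "u \<in> U"
      have x: "\<phi> u \<in> S" using chart_facts(5)[OF lp] .
      obtain \<mu> where \<mu>: "fst (N (\<phi> u)) = \<mu> *\<^sub>R (a - d *\<^sub>R fst (F (\<phi> u)))"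
        using circle_normal[OF a on x] .
      obtain c I s where c: "regular_curve_in ?C c I" "s \<in> I" "c s = fst (F (\<phi> u))"
        "geodesic_curvature c (fst (N (\<phi> u))) s = 2 * \<Lambda>"
        using curv[OF x] unfolding has_geodesic_curvature_def by blast
      have "\<mu> * d = 2 * \<Lambda>"
        using geodesic_curvature_in_circle[OF c(1) equalityD1[OF C] c(2), of \<mu>] c(3,4) \<mu> by simp
      moreover have "N (\<phi> u) \<bullet> dz = 0"
        by (subst normal_horizontal(1)[OF x]) (simp add: dz_def inner_prod_def)
      ultimately show "mean_curvature (F \<circ> \<phi>) (N (\<phi> u)) u = N (\<phi> u) \<bullet> dz + \<Lambda>"
        using circle_mean_curvature[OF on lp \<mu>] by simp
    qed
  }
qed

end
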